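(* Let $\mathcal{H}$ be a complex Hilbert space, let $A\in\mathcal{B}(\mathcal{H})$ and let $0\le t\le 1$. Then for any $p\ge 1$, $$\omega^{2p}(A)\le\left\|(1-t)|A^*|^{2p}+t|A|^{2p}-2r\left(\frac{|A|^{2p}+|A^*|^{2p}}{2}-\left(\frac{|A|^p+|A^*|^p}{2}\right)^2\right)\right\|,$$ where $r=\min\{t,1-t\}$.
   Context: $\mathcal{B}(\mathcal{H})$ is the algebra of bounded linear operators on $\mathcal{H}$, $\|\cdot\|$ is the operator norm, $|A|=(A^*A)^{1/2}$, and $\omega(A)=\sup\{|\langle Ax,x\rangle|:x\in\mathcal{H},\ \|x\|=1\}$ is the numerical radius; $\omega^{2p}(A)=(\omega(A))^{2p}$. *)

theory Defs
  imports "HOL-Analysis.Analysis" "HOL-Computational_Algebra.Polynomial"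
begin

text \<open>
  Complex Hilbert spaces. Completeness and the norm come from class \<open>banach\<close>; the last axiom says
  that this norm is the one induced by the inner product and contains positive definiteness.
  The inner product is linear in its first argument.
\<close>

class complex_hilbert = banach +
  fixes scaleC :: "complex \<Rightarrow> 'a \<Rightarrow> 'a"  (infixr "*\<^sub>C" 75)
    and cinner :: "'a \<Rightarrow> 'a \<Rightarrow> complex"
  assumes scaleC_add_right: "a *\<^sub>C (x + y) = a *\<^sub>C x + a *\<^sub>C y"
    and scaleC_add_left: "(a + b) *\<^sub>C x = a *\<^sub>C x + b *\<^sub>C x"
    and scaleC_scaleC: "a *\<^sub>C (b *\<^sub>C x) = (a * b) *\<^sub>C x"
    and scaleC_one: "1 *\<^sub>C x = x"
    and scaleR_scaleC: "s *\<^sub>R x = complex_of_real s *\<^sub>C x"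
    and cinner_commute: "cinner x y = cnj (cinner y x)"
    and cinner_add_left: "cinner (x + y) z = cinner x z + cinner y z"
    and cinner_scaleC_left: "cinner (a *\<^sub>C x) y = a * cinner x y"
    and cinner_self: "cinner x x = complex_of_real ((norm x)\<^sup>2)"

instantiation complex :: complex_hilbert
begin

definition scaleC_complex :: "complex \<Rightarrow> complex \<Rightarrow> complex"
  where "scaleC_complex a x = a * x"

definition cinner_complex :: "complex \<Rightarrow> complex \<Rightarrow> complex"
  where "cinner_complex x y = x * cnj y"

instance
  by standard
    (simp_all add: scaleC_complex_def cinner_complex_def algebra_simps scaleR_conv_of_real
      complex_norm_square del: of_real_power)

end

text \<open>
  The algebra of bounded linear operators: \<open>'a \<Rightarrow>\<^sub>L 'a\<close> consists of the bounded real-linear maps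
  and carries the operator norm, so complex homogeneity has to be added.
\<close>

definition bounded_ops :: "('a::complex_hilbert \<Rightarrow>\<^sub>L 'a) set"
  where "bounded_ops = {T. \<forall>c x. blinfun_apply T (c *\<^sub>C x) = c *\<^sub>C blinfun_apply T x}"

definition op_adjoint :: "('a::complex_hilbert \<Rightarrow>\<^sub>L 'a) \<Rightarrow> ('a \<Rightarrow>\<^sub>L 'a)"
  where "op_adjoint T =
    (THE S. S \<in> bounded_ops \<and>
      (\<forall>x y. cinner (blinfun_apply T x) y = cinner x (blinfun_apply S y)))"

definition op_spectrum :: "('a::complex_hilbert \<Rightarrow>\<^sub>L 'a) \<Rightarrow> complex set"
  where "op_spectrum T =
    {c. \<not> (\<exists>S \<in> bounded_ops. \<forall>x.
        blinfun_apply S (blinfun_apply T x - c *\<^sub>C x) = x \<and>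
        blinfun_apply T (blinfun_apply S x) - c *\<^sub>C blinfun_apply S x = x)}"

definition op_npow :: "('a::real_normed_vector \<Rightarrow>\<^sub>L 'a) \<Rightarrow> nat \<Rightarrow> ('a \<Rightarrow>\<^sub>L 'a)"
  where "op_npow T n = (((o\<^sub>L) T) ^^ n) id_blinfun"

definition op_poly :: "real poly \<Rightarrow> ('a::real_normed_vector \<Rightarrow>\<^sub>L 'a) \<Rightarrow> ('a \<Rightarrow>\<^sub>L 'a)"
  where "op_poly q T = (\<Sum>i\<le>degree q. coeff q i *\<^sub>R op_npow T i)"

text \<open>
  Continuous functional calculus of a self-adjoint operator \<open>T\<close> for a real function \<open>f\<close>
  continuous on the (real) spectrum of \<open>T\<close>: the continuous extension of the polynomial calculus,
  i.e. \<open>f(T)\<close> is the norm limit of \<open>q\<^sub>n(T)\<close> whenever the polynomials \<open>q\<^sub>n\<close> converge to \<open>f\<close> uniformly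
  on the spectrum. The value is meaningless if \<open>T\<close> is not self-adjoint or \<open>f\<close> not continuous there.
\<close>

definition op_fun :: "(real \<Rightarrow> real) \<Rightarrow> ('a::complex_hilbert \<Rightarrow>\<^sub>L 'a) \<Rightarrow> ('a \<Rightarrow>\<^sub>L 'a)"
  where "op_fun f T =
    (THE S. \<forall>q :: nat \<Rightarrow> real poly.
        uniform_limit {s. complex_of_real s \<in> op_spectrum T} (\<lambda>n. poly (q n)) f sequentially \<longrightarrow>
        (\<lambda>n. op_poly (q n) T) \<longlonglongrightarrow> S)"

text \<open>Real powers, for positive operators and positive exponents (note \<open>0 powr a = 0\<close>).\<close>

definition op_powr :: "('a::complex_hilbert \<Rightarrow>\<^sub>L 'a) \<Rightarrow> real \<Rightarrow> ('a \<Rightarrow>\<^sub>L 'a)"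
  where "op_powr T a = op_fun (\<lambda>s. s powr a) T"

definition op_abs :: "('a::complex_hilbert \<Rightarrow>\<^sub>L 'a) \<Rightarrow> ('a \<Rightarrow>\<^sub>L 'a)"
  where "op_abs T = op_powr (op_adjoint T o\<^sub>L T) (1/2)"

text \<open>
  Inserting \<open>0\<close> only matters for the zero space, which has no unit vectors: the supremum of the
  empty set of nonnegative numbers is then \<open>0\<close>, whereas \<open>Sup {}\<close> is unspecified on the reals.
\<close>

definition numerical_radius :: "('a::complex_hilbert \<Rightarrow>\<^sub>L 'a) \<Rightarrow> real"
  where "numerical_radius T =
    Sup (insert 0 {cmod (cinner (blinfun_apply T x) x) | x. norm x = 1})"

end

theory Submission
  imports Defs "HOL-Computational_Algebra.Fundamental_Theorem_Algebra"
begin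

text \<open>
  Write \<open>B = |A|\<^sup>p\<close>, \<open>C = |A\<^sup>*|\<^sup>p\<close> and \<open>D = (B + C) / 2\<close>. The operator on the right-hand side is the convex
  combination \<open>(1 - 2r) X\<^sup>2 + 2r D\<^sup>2\<close>, where \<open>X = C\<close> if \<open>t \<le> 1/2\<close> and \<open>X = B\<close> otherwise, so it suffices
  to bound \<open>|\<langle>Ax, x\<rangle>|\<^sup>2\<^sup>p\<close> by the quadratic forms of \<open>B\<^sup>2\<close>, \<open>C\<^sup>2\<close> and \<open>D\<^sup>2\<close> at each unit vector \<open>x\<close>. The
  first two bounds follow from \<open>|\<langle>Ax, x\<rangle>| \<le> \<parallel>Ax\<parallel>, \<parallel>A\<^sup>*x\<parallel>\<close> and McCarthy's inequality; for \<open>D\<^sup>2\<close> one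
  combines the mixed Schwarz inequality, McCarthy's inequality and AM-GM.

  The functional calculus rests on \<open>\<parallel>q(T)\<parallel> \<le> sup |q|\<close> over the spectrum for hermitian \<open>T\<close>: the
  operator \<open>q(T)\<^sup>2 - \<parallel>q(T)\<parallel>\<^sup>2\<close> is not bounded below, hence neither is \<open>T - z\<close> for some complex root \<open>z\<close>
  of \<open>q\<^sup>2 - \<parallel>q(T)\<parallel>\<^sup>2\<close>, and such a \<open>z\<close> is a real point of the spectrum.
\<close>

section \<open>Complex Hilbert spaces and adjoints\<close>

lemma scaleC_zero_left [simp]: "0 *\<^sub>C x = (0::'a::complex_hilbert)"
  using scaleC_add_left[of 0 0 x] by simp

lemma scaleC_zero_right [simp]: "a *\<^sub>C (0::'a::complex_hilbert) = 0"
  using scaleC_add_right[of a 0 "0::'a"] by simp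

lemma scaleC_minus_right: "a *\<^sub>C (- x) = - (a *\<^sub>C (x::'a::complex_hilbert))"
  by (metis add_eq_0_iff ab_left_minus scaleC_add_right scaleC_zero_right)

lemma scaleC_diff_right: "a *\<^sub>C (x - y) = a *\<^sub>C x - a *\<^sub>C (y::'a::complex_hilbert)"
  by (metis diff_conv_add_uminus scaleC_add_right scaleC_minus_right)

lemma scaleC_scaleR: "c *\<^sub>C (s *\<^sub>R x) = s *\<^sub>R (c *\<^sub>C (x::'a::complex_hilbert))"
  by (simp add: scaleR_scaleC scaleC_scaleC mult.commute)

lemma scaleC_sum_right:
  "c *\<^sub>C (\<Sum>i\<in>I. f i) = (\<Sum>i\<in>I. c *\<^sub>C (f i :: 'a::complex_hilbert))"
  by (induction I rule: infinite_finite_induct) (auto simp: scaleC_add_right)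

lemma cinner_add_right: "cinner x (y + z) = cinner x y + cinner (x::'a::complex_hilbert) z"
  by (metis cinner_add_left cinner_commute complex_cnj_add)

lemma cinner_scaleC_right: "cinner x (a *\<^sub>C y) = cnj a * cinner (x::'a::complex_hilbert) y"
  by (metis cinner_commute cinner_scaleC_left complex_cnj_mult)

lemma cinner_zero_left [simp]: "cinner 0 (x::'a::complex_hilbert) = 0"
  by (metis cinner_scaleC_left mult_zero_left scaleC_zero_left)

lemma cinner_zero_right [simp]: "cinner (x::'a::complex_hilbert) 0 = 0"
  by (metis cinner_commute cinner_zero_left complex_cnj_zero)

lemma cinner_minus_left: "cinner (- x) y = - cinner (x::'a::complex_hilbert) y"
  by (metis add_eq_0_iff ab_left_minus cinner_add_left cinner_zero_left)

lemma cinner_minus_right: "cinner x (- y) = - cinner (x::'a::complex_hilbert) y"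
  by (metis add_eq_0_iff ab_left_minus cinner_add_right cinner_zero_right)

lemma cinner_diff_left: "cinner (x - y) z = cinner x z - cinner (y::'a::complex_hilbert) z"
  by (metis cinner_add_left cinner_minus_left diff_conv_add_uminus)

lemma cinner_diff_right: "cinner x (y - z) = cinner x y - cinner (x::'a::complex_hilbert) z"
  by (metis cinner_add_right cinner_minus_right diff_conv_add_uminus)

lemma cinner_scaleR_left: "cinner (s *\<^sub>R x) y = complex_of_real s * cinner (x::'a::complex_hilbert) y"
  by (simp add: scaleR_scaleC cinner_scaleC_left)

lemma cinner_scaleR_right: "cinner x (s *\<^sub>R y) = complex_of_real s * cinner (x::'a::complex_hilbert) y"
  by (simp add: scaleR_scaleC cinner_scaleC_right)

lemmas cinner_simps = cinner_add_left cinner_add_right cinner_diff_left cinner_diff_right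
  cinner_minus_left cinner_minus_right cinner_scaleC_left cinner_scaleC_right
  cinner_scaleR_left cinner_scaleR_right

lemma Re_cinner_self: "Re (cinner x x) = (norm (x::'a::complex_hilbert))\<^sup>2"
  by (simp add: cinner_self)

lemma Re_cinner_commute: "Re (cinner y x) = Re (cinner (x::'a::complex_hilbert) y)"
  by (subst cinner_commute) simp

lemma cinner_nondegenerate:
  assumes "\<And>x. cinner x y = cinner x (z::'a::complex_hilbert)"
  shows "y = z"
proof -
  have "cinner (y - z) (y - z) = 0"
    by (simp only: cinner_diff_right assms diff_self)
  then show ?thesis
    by (simp add: cinner_self)
qed

section \<open>Cauchy-Schwarz inequality, orthogonal projection, Riesz representation\<close>

lemma norm_add_sq:
  "(norm (x + y))\<^sup>2 = (norm x)\<^sup>2 + 2 * Re (cinner x y) + (norm (y::'a::complex_hilbert))\<^sup>2"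
  by (simp flip: Re_cinner_self add: cinner_simps Re_cinner_commute[of y x])

lemma norm_diff_sq:
  "(norm (x - y))\<^sup>2 = (norm x)\<^sup>2 - 2 * Re (cinner x y) + (norm (y::'a::complex_hilbert))\<^sup>2"
  by (simp flip: Re_cinner_self add: cinner_simps Re_cinner_commute[of y x])

lemma norm_scaleC: "norm (c *\<^sub>C x) = cmod c * norm (x::'a::complex_hilbert)"
proof -
  have "complex_of_real ((norm (c *\<^sub>C x))\<^sup>2) = (c * cnj c) * cinner x x"
    unfolding cinner_self[symmetric] by (simp add: cinner_simps)
  also have "\<dots> = complex_of_real ((cmod c * norm x)\<^sup>2)"
    by (simp add: complex_norm_square cinner_self power_mult_distrib del: of_real_power)
  finally have "(norm (c *\<^sub>C x))\<^sup>2 = (cmod c * norm x)\<^sup>2"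
    using of_real_eq_iff by blast
  then show ?thesis
    by (simp add: power2_eq_iff_nonneg)
qed

text \<open>The triangle inequality is an axiom of the norm, so Cauchy-Schwarz for the real part
  comes from squaring it and expanding, in the reverse of the usual order.\<close>

lemma Re_cinner_le: "Re (cinner x y) \<le> norm x * norm (y::'a::complex_hilbert)"
proof -
  have "(norm (x + y))\<^sup>2 \<le> (norm x + norm y)\<^sup>2"
    by (intro power_mono norm_triangle_ineq) auto
  then show ?thesis
    by (simp add: norm_add_sq power2_sum)
qed

lemma cmod_cinner_le: "cmod (cinner x y) \<le> norm x * norm (y::'a::complex_hilbert)"
proof (cases "cinner x y = 0")
  case False
  \<comment> \<open>Multiplying \<open>x\<close> by this unimodular scalar rotates the inner product
    onto the nonnegative real axis, which reduces the modulus to the real part.\<close>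
  define c where "c = cnj (sgn (cinner x y))"
  have c: "cmod c = 1"
    using False by (simp add: c_def norm_sgn)
  have "complex_of_real (cmod (cinner x y)) = c * cinner x y"
    using False
    by (simp add: c_def sgn_eq field_simps flip: complex_norm_square power2_eq_square)
  then have "cmod (cinner x y) = Re (cinner (c *\<^sub>C x) y)"
    by (metis Re_complex_of_real cinner_scaleC_left)
  also have "\<dots> \<le> norm x * norm y"
    using Re_cinner_le[of "c *\<^sub>C x" y] by (simp add: norm_scaleC c)
  finally show ?thesis .
qed simp

lemma bounded_bilinear_cinner:
  "bounded_bilinear (cinner :: 'a::complex_hilbert \<Rightarrow> 'a \<Rightarrow> complex)"
proof
  show "\<exists>K. \<forall>x y::'a. norm (cinner x y) \<le> norm x * norm y * K"
    using cmod_cinner_le by (intro exI[of _ 1]) auto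
qed (auto simp: cinner_simps scaleR_conv_of_real)

lemmas tendsto_cinner [tendsto_intros] = bounded_bilinear.tendsto[OF bounded_bilinear_cinner]

lemma bounded_linear_scaleC: "bounded_linear (\<lambda>x::'a::complex_hilbert. c *\<^sub>C x)"
  by (rule bounded_linear_intro[of _ "cmod c"])
     (auto simp: scaleC_add_right scaleC_scaleR norm_scaleC)

lemmas tendsto_scaleC [tendsto_intros] = bounded_linear.tendsto[OF bounded_linear_scaleC]

text \<open>The witness is the point of \<open>M\<close> nearest to \<open>y\<close>: a minimising
  sequence is Cauchy by the parallelogram law, and minimality makes the residual orthogonal to
  \<open>M\<close>. \<open>MC\<close> is a separate hypothesis because \<open>subspace\<close> only
  speaks of real scalars.\<close>

lemma orthogonal_projection_exists:
  fixes y :: "'a::complex_hilbert"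
  assumes M: "subspace M" "closed M" and MC: "\<And>c x. x \<in> M \<Longrightarrow> c *\<^sub>C x \<in> M"
  shows "\<exists>m\<in>M. \<forall>v\<in>M. cinner (y - m) v = 0"
proof -
  define d where "d = infdist y M"
  have ne: "M \<noteq> {}"
    using subspace_0[OF M(1)] by auto
  have d0: "0 \<le> d"
    by (simp add: d_def infdist_nonneg)
  have dle: "d \<le> norm (y - v)" if "v \<in> M" for v
    using infdist_le[OF that, of y] by (simp add: d_def dist_norm)
  have "\<exists>v\<in>M. norm (y - v) < d + 1 / Suc n" for n
  proof (rule ccontr)
    assume "\<not> ?thesis"
    then have "d + 1 / Suc n \<le> infdist y M"
      using ne by (auto simp: infdist_def dist_norm not_less intro!: cINF_greatest)
    then show False
      by (simp add: d_def)
  qed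
  then obtain s where s: "\<And>n. s n \<in> M" "\<And>n. norm (y - s n) < d + 1 / Suc n"
    by metis
  have lim: "(\<lambda>n. norm (y - s n)) \<longlonglongrightarrow> d"
  proof (rule tendsto_sandwich[where f = "\<lambda>_. d" and h = "\<lambda>n. d + 1 / Suc n"])
    show "(\<lambda>n. d + 1 / Suc n) \<longlonglongrightarrow> d"
      using tendsto_add[OF tendsto_const LIMSEQ_inverse_real_of_nat, of d]
      by (simp add: inverse_eq_divide)
  qed (use dle s in \<open>auto intro!: always_eventually less_imp_le\<close>)
  \<comment> \<open>parallelogram law, and the midpoint of two points of \<open>M\<close> lies in \<open>M\<close>\<close>
  have par: "(norm (s m - s n))\<^sup>2 \<le> 2 * (norm (y - s m))\<^sup>2 + 2 * (norm (y - s n))\<^sup>2 - 4 * d\<^sup>2" for m n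
  proof -
    have "(1/2) *\<^sub>R (s m + s n) \<in> M"
      using M(1) s by (intro subspace_scale subspace_add) auto
    from dle[OF this] have "2 * d \<le> 2 * norm (y - (1/2) *\<^sub>R (s m + s n))"
      by simp
    also have "\<dots> = norm ((y - s m) + (y - s n))"
    proof -
      have "(y - s m) + (y - s n) = 2 *\<^sub>R (y - (1/2) *\<^sub>R (s m + s n))"
        by (simp add: algebra_simps scaleR_2)
      then show ?thesis
        by simp
    qed
    finally have "(2 * d)\<^sup>2 \<le> (norm ((y - s m) + (y - s n)))\<^sup>2"
      using d0 by (intro power_mono) auto
    moreover have "(norm (s m - s n))\<^sup>2 = (norm ((y - s m) - (y - s n)))\<^sup>2"
      by (simp add: norm_minus_commute)
    ultimately show ?thesis
      unfolding norm_add_sq[of "y - s m"] norm_diff_sq[of "y - s m"] by simp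
  qed
  have "Cauchy s"
  proof (rule metric_CauchyI)
    fix e :: real assume e: "0 < e"
    have "(\<lambda>n. (norm (y - s n))\<^sup>2) \<longlonglongrightarrow> d\<^sup>2"
      by (intro tendsto_intros lim)
    moreover have "d\<^sup>2 < d\<^sup>2 + e\<^sup>2 / 4"
      using e by simp
    ultimately have "\<forall>\<^sub>F n in sequentially. (norm (y - s n))\<^sup>2 < d\<^sup>2 + e\<^sup>2 / 4"
      by (rule order_tendstoD)
    then obtain N where N: "\<And>n. n \<ge> N \<Longrightarrow> (norm (y - s n))\<^sup>2 < d\<^sup>2 + e\<^sup>2 / 4"
      by (auto simp: eventually_sequentially)
    have "dist (s m) (s n) < e" if "m \<ge> N" "n \<ge> N" for m n
    proof -
      have "(norm (s m - s n))\<^sup>2 < e\<^sup>2"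
        using par[of m n] N[OF that(1)] N[OF that(2)] by simp
      then show ?thesis
        using e by (simp add: dist_norm power_less_imp_less_base)
    qed
    then show "\<exists>N. \<forall>m\<ge>N. \<forall>n\<ge>N. dist (s m) (s n) < e"
      by blast
  qed
  then obtain m where m: "s \<longlonglongrightarrow> m"
    using Cauchy_convergent convergent_def by blast
  have mM: "m \<in> M"
    using closed_sequentially[OF M(2)] s(1) m by blast
  have "(\<lambda>n. norm (y - s n)) \<longlonglongrightarrow> norm (y - m)"
    by (intro tendsto_intros m)
  then have dm: "norm (y - m) = d"
    using lim LIMSEQ_unique by blast
  have Re0: "Re (cinner (y - m) v) \<le> 0" if v: "v \<in> M" for v
  proof (rule ccontr)
    assume neg: "\<not> ?thesis"
    define a where "a = Re (cinner (y - m) v)"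
    \<comment> \<open>Moving \<open>m\<close> by \<open>h *\<^sub>R v\<close> changes the squared
      distance by at most \<open>- h * a\<close>, which contradicts minimality. The
      \<open>+ 1\<close> keeps the denominator positive without a case distinction on
      \<open>v\<close>.\<close>
    define h where "h = a / ((norm v)\<^sup>2 + 1)"
    have a: "0 < a"
      using neg by (simp add: a_def)
    have pos: "0 < (norm v)\<^sup>2 + 1"
      by (simp add: add_nonneg_pos)
    have h: "0 < h" "h * (norm v)\<^sup>2 \<le> a"
      using a pos by (auto simp: h_def field_simps)
    have "d\<^sup>2 \<le> (norm (y - (m + h *\<^sub>R v)))\<^sup>2"
      using d0 mM v M(1) by (intro power_mono dle subspace_add subspace_scale) auto
    also have "y - (m + h *\<^sub>R v) = (y - m) - h *\<^sub>R v"
      by simp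
    also have "(norm ((y - m) - h *\<^sub>R v))\<^sup>2 = d\<^sup>2 - 2 * h * a + h * (h * (norm v)\<^sup>2)"
      unfolding norm_diff_sq[of "y - m"]
      using h by (simp add: dm a_def cinner_scaleR_right power_mult_distrib power2_eq_square)
    also have "\<dots> \<le> d\<^sup>2 - 2 * h * a + h * a"
      using h by (intro add_left_mono mult_left_mono) auto
    also have "\<dots> < d\<^sup>2"
      using h a by simp
    finally show False
      by simp
  qed
  have "cinner (y - m) v = 0" if v: "v \<in> M" for v
  proof -
    have "- v \<in> M"
      using M(1) v by (rule subspace_neg)
    \<comment> \<open>The four directions \<open>v\<close>, \<open>-v\<close> and plus or minus
      \<open>\<i>\<close> times \<open>v\<close> force both the real and the imaginary part to
      vanish.\<close>
    note R = Re0[OF v] Re0[OF this] Re0[OF MC[OF v, of \<i>]] Re0[OF MC[OF v, of "-\<i>"]]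
    then show ?thesis
      by (simp add: cinner_simps complex_eq_iff)
  qed
  then show ?thesis
    using mM by blast
qed

text \<open>The kernel is closed, and a vector \<open>w\<close> orthogonal to it spans a complement:
  every \<open>x\<close> differs from a multiple of \<open>w\<close> by an element of the kernel. So
  a multiple of \<open>w\<close> represents the functional.\<close>

lemma riesz_representation:
  fixes \<phi> :: "'a::complex_hilbert \<Rightarrow> complex"
  assumes bl: "bounded_linear \<phi>" and C: "\<And>c x. \<phi> (c *\<^sub>C x) = c * \<phi> x"
  shows "\<exists>z. \<forall>x. \<phi> x = cinner x z"
proof (cases "\<forall>x. \<phi> x = 0")
  case True
  then show ?thesis
    by (intro exI[of _ 0]) simp
next
  case False
  then obtain y where y: "\<phi> y \<noteq> 0"
    by blast
  interpret bounded_linear \<phi> by fact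
  define M where "M = {x. \<phi> x = 0}"
  have "subspace M"
    by (auto simp: M_def subspace_def add scaleR)
  moreover have "closed M"
    unfolding M_def
    by (rule closed_Collect_eq) (auto intro!: continuous_intros linear_continuous_on bl)
  ultimately obtain m where m: "m \<in> M" "\<And>v. v \<in> M \<Longrightarrow> cinner (y - m) v = 0"
    using orthogonal_projection_exists[of M y] C by (auto simp: M_def)
  define w where "w = y - m"
  have \<phi>w: "\<phi> w \<noteq> 0"
    using y m(1) by (simp add: w_def diff M_def)
  then have w: "cinner w w \<noteq> 0"
    using zero by (auto simp: cinner_self)
  \<comment> \<open>The coefficient of \<open>w\<close> is conjugated because \<open>cinner\<close>
    is conjugate-linear in its second argument.\<close>
  have "\<phi> x = cinner x ((cnj (\<phi> w) / cinner w w) *\<^sub>C w)" for x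
  proof -
    have "\<phi> (x - (\<phi> x / \<phi> w) *\<^sub>C w) = 0"
      using \<phi>w by (simp add: diff C)
    then have "cinner w (x - (\<phi> x / \<phi> w) *\<^sub>C w) = 0"
      using m(2) by (simp add: M_def w_def)
    then have "cinner (x - (\<phi> x / \<phi> w) *\<^sub>C w) w = 0"
      by (metis cinner_commute complex_cnj_zero)
    then have "cinner x w = \<phi> x / \<phi> w * cinner w w"
      by (simp add: cinner_simps)
    then show ?thesis
      using w \<phi>w by (simp add: cinner_simps cinner_self field_simps)
  qed
  then show ?thesis
    by blast
qed

text \<open>Riesz representation of the functional sending \<open>x\<close> to
  \<open>cinner (T x) y\<close> gives \<open>S y\<close>. Nondegeneracy makes \<open>S\<close>
  linear, and its bound comes from the square of \<open>norm (S x)\<close> being the real part of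
  \<open>cinner (T (S x)) x\<close>.\<close>

lemma adjoint_exists:
  fixes T :: "'a::complex_hilbert \<Rightarrow>\<^sub>L 'a"
  assumes T: "T \<in> bounded_ops"
  shows "\<exists>S\<in>bounded_ops. \<forall>x y. cinner (blinfun_apply T x) y = cinner x (blinfun_apply S y)"
proof -
  have "\<exists>z. \<forall>x. cinner (blinfun_apply T x) y = cinner x z" for y
  proof (rule riesz_representation)
    show "bounded_linear (\<lambda>x. cinner (blinfun_apply T x) y)"
      by (rule bounded_linear_compose[OF bounded_bilinear.bounded_linear_left[OF bounded_bilinear_cinner]
            blinfun.bounded_linear_right])
    show "cinner (blinfun_apply T (c *\<^sub>C x)) y = c * cinner (blinfun_apply T x) y" for c x
      using T by (simp add: bounded_ops_def cinner_simps)
  qed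
  then obtain S where S: "\<And>x y. cinner (blinfun_apply T x) y = cinner x (S y)"
    by metis
  have SC: "S (c *\<^sub>C x) = c *\<^sub>C S x" for c x
    by (rule cinner_nondegenerate) (simp add: cinner_simps flip: S)
  have "bounded_linear S"
  proof (rule bounded_linear_intro)
    show "S (x + y) = S x + S y" for x y
      by (rule cinner_nondegenerate) (simp add: cinner_simps flip: S)
    show "S (r *\<^sub>R x) = r *\<^sub>R S x" for r x
      by (simp add: scaleR_scaleC SC)
    show "norm (S x) \<le> norm x * norm T" for x
    proof (cases "S x = 0")
      case False
      have "(norm (S x))\<^sup>2 = Re (cinner (blinfun_apply T (S x)) x)"
        by (simp add: S Re_cinner_self)
      also have "\<dots> \<le> (norm T * norm (S x)) * norm x"
        by (rule order_trans[OF Re_cinner_le]) (intro mult_right_mono norm_blinfun norm_ge_zero)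
      finally show ?thesis
        using False by (simp add: power2_eq_square field_simps)
    qed simp
  qed
  then have "blinfun_apply (Blinfun S) = S"
    by (rule bounded_linear_Blinfun_apply)
  then show ?thesis
    using S SC by (intro bexI[of _ "Blinfun S"]) (auto simp: bounded_ops_def)
qed

text \<open>Existence together with uniqueness, the latter by nondegeneracy, unlocks the description
  operator in the definition of the adjoint.\<close>

lemma op_adjoint:
  fixes T :: "'a::complex_hilbert \<Rightarrow>\<^sub>L 'a"
  assumes "T \<in> bounded_ops"
  shows op_adjoint_bounded_ops: "op_adjoint T \<in> bounded_ops"
    and cinner_op_adjoint:
      "cinner (blinfun_apply T x) y = cinner x (blinfun_apply (op_adjoint T) y)"
proof -
  have "\<exists>!S. S \<in> bounded_ops \<and> (\<forall>x y. cinner (blinfun_apply T x) y = cinner x (blinfun_apply S y))"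
  proof (rule ex_ex1I)
    show "S = S'" if
      "S \<in> bounded_ops \<and> (\<forall>x y. cinner (blinfun_apply T x) y = cinner x (blinfun_apply S y))"
      "S' \<in> bounded_ops \<and> (\<forall>x y. cinner (blinfun_apply T x) y = cinner x (blinfun_apply S' y))"
      for S S'
    proof (rule blinfun_eqI, rule cinner_nondegenerate)
      show "cinner x (blinfun_apply S y) = cinner x (blinfun_apply S' y)" for x y
        using that by metis
    qed
  qed (use adjoint_exists[OF assms] in blast)
  from theI'[OF this, folded op_adjoint_def] show "op_adjoint T \<in> bounded_ops"
    and "cinner (blinfun_apply T x) y = cinner x (blinfun_apply (op_adjoint T) y)"
    by blast+
qed

lemma cinner_op_adjoint':
  "T \<in> bounded_ops \<Longrightarrow>
    cinner (blinfun_apply (op_adjoint T) x) y = cinner x (blinfun_apply T y)"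
  by (metis cinner_commute cinner_op_adjoint)

lemma op_adjoint_op_adjoint:
  assumes "T \<in> bounded_ops"
  shows "op_adjoint (op_adjoint T) = T"
  by (rule blinfun_eqI, rule cinner_nondegenerate)
     (metis assms cinner_op_adjoint cinner_op_adjoint' op_adjoint_bounded_ops)

section \<open>Spectrum and polynomial calculus of hermitian operators\<close>

text \<open>Self-adjointness as symmetry of the form, which passes to sums, limits and polynomials
  without reference to \<open>op_adjoint\<close>.\<close>

definition hermitian_op :: "('a::complex_hilbert \<Rightarrow>\<^sub>L 'a) \<Rightarrow> bool"
  where "hermitian_op T \<longleftrightarrow>
    T \<in> bounded_ops \<and> (\<forall>x y. cinner (blinfun_apply T x) y = cinner x (blinfun_apply T y))"

text \<open>Failure for \<open>T - z\<close> says that \<open>z\<close> is an approximate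
  eigenvalue. Arbitrary functions are allowed so that complex shifts and complex polynomials of
  \<open>T\<close> are covered.\<close>

definition bounded_below :: "('a::real_normed_vector \<Rightarrow> 'b::real_normed_vector) \<Rightarrow> bool"
  where "bounded_below f \<longleftrightarrow> (\<exists>c>0. \<forall>x. c * norm x \<le> norm (f x))"

text \<open>This is the set on which \<open>op_fun\<close> asks for uniform convergence.\<close>

definition real_spectrum :: "('a::complex_hilbert \<Rightarrow>\<^sub>L 'a) \<Rightarrow> real set"
  where "real_spectrum T = {s. complex_of_real s \<in> op_spectrum T}"

lemma bounded_ops_scaleC:
  "T \<in> bounded_ops \<Longrightarrow> blinfun_apply T (c *\<^sub>C x) = c *\<^sub>C blinfun_apply T x"
  by (simp add: bounded_ops_def)

lemma hermitian_op_bounded_ops: "hermitian_op T \<Longrightarrow> T \<in> bounded_ops"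
  by (simp add: hermitian_op_def)

lemma hermitian_opD:
  "hermitian_op T \<Longrightarrow> cinner (blinfun_apply T x) y = cinner x (blinfun_apply T y)"
  by (simp add: hermitian_op_def)

lemma hermitian_op_add: "hermitian_op S \<Longrightarrow> hermitian_op T \<Longrightarrow> hermitian_op (S + T)"
  by (simp add: hermitian_op_def bounded_ops_def blinfun.add_left cinner_simps scaleC_add_right)

lemma hermitian_op_diff: "hermitian_op S \<Longrightarrow> hermitian_op T \<Longrightarrow> hermitian_op (S - T)"
  by (simp add: hermitian_op_def bounded_ops_def blinfun.diff_left cinner_simps scaleC_diff_right)

lemma hermitian_op_scaleR: "hermitian_op T \<Longrightarrow> hermitian_op (s *\<^sub>R T)"
  by (simp add: hermitian_op_def bounded_ops_def blinfun.scaleR_left cinner_simps scaleC_scaleR)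

lemma hermitian_op_id: "hermitian_op id_blinfun"
  by (simp add: hermitian_op_def bounded_ops_def)

lemma hermitian_op_limit:
  assumes "\<And>n. hermitian_op (S n)" and lim: "S \<longlonglongrightarrow> T"
  shows "hermitian_op T"
proof -
  have app: "(\<lambda>n. blinfun_apply (S n) x) \<longlonglongrightarrow> blinfun_apply T x" for x
    by (intro tendsto_intros lim)
  have "(\<lambda>n. blinfun_apply (S n) (c *\<^sub>C x)) \<longlonglongrightarrow> c *\<^sub>C blinfun_apply T x" for c x
    using tendsto_scaleC[OF app] assms(1) by (simp add: hermitian_op_def bounded_ops_def)
  then have "blinfun_apply T (c *\<^sub>C x) = c *\<^sub>C blinfun_apply T x" for c x
    using app LIMSEQ_unique by blast
  moreover have "(\<lambda>n. cinner (blinfun_apply (S n) x) y) \<longlonglongrightarrow> cinner x (blinfun_apply T y)" for x y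
    using tendsto_cinner[OF tendsto_const app] assms(1) by (simp add: hermitian_op_def)
  then have "cinner (blinfun_apply T x) y = cinner x (blinfun_apply T y)" for x y
    using tendsto_cinner[OF app tendsto_const] LIMSEQ_unique by blast
  ultimately show ?thesis
    by (simp add: hermitian_op_def bounded_ops_def)
qed

lemma hermitian_op_Im_cinner:
  assumes "hermitian_op T"
  shows "Im (cinner (blinfun_apply T x) x) = 0"
proof -
  have "cinner (blinfun_apply T x) x = cnj (cinner (blinfun_apply T x) x)"
    using assms by (metis cinner_commute hermitian_opD)
  then show ?thesis
    by (metis Reals_cnj_iff complex_is_Real_iff)
qed

section \<open>Lower bounds and the location of the spectrum\<close>

lemma norm_shift_ge_Re:
  fixes T :: "'a::complex_hilbert \<Rightarrow>\<^sub>L 'a"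
  assumes "s < 0" and "0 \<le> Re (cinner (blinfun_apply T x) x)"
  shows "- s * norm x \<le> norm (blinfun_apply T x - complex_of_real s *\<^sub>C x)"
proof (cases "x = 0")
  case False
  have "- s * (norm x)\<^sup>2 \<le> Re (cinner (blinfun_apply T x - complex_of_real s *\<^sub>C x) x)"
    using assms by (simp add: cinner_simps Re_cinner_self)
  also have "\<dots> \<le> norm (blinfun_apply T x - complex_of_real s *\<^sub>C x) * norm x"
    by (rule Re_cinner_le)
  finally have "(- s * norm x) * norm x \<le> norm (blinfun_apply T x - complex_of_real s *\<^sub>C x) * norm x"
    by (simp add: power2_eq_square mult.assoc)
  then show ?thesis
    using False by (subst (asm) mult_le_cancel_right_pos) auto
qed simp

text \<open>The form of \<open>T\<close> is real, so the imaginary part of the form of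
  \<open>T - z\<close> is \<open>- Im z\<close> times the squared norm; Cauchy-Schwarz then gives
  the bound. Approximate eigenvalues are therefore real.\<close>

lemma hermitian_op_norm_shift_ge_Im:
  fixes T :: "'a::complex_hilbert \<Rightarrow>\<^sub>L 'a"
  assumes "hermitian_op T"
  shows "\<bar>Im z\<bar> * norm x \<le> norm (blinfun_apply T x - z *\<^sub>C x)"
proof (cases "x = 0")
  case False
  have "\<bar>Im z\<bar> * (norm x)\<^sup>2 = \<bar>Im (cinner (blinfun_apply T x - z *\<^sub>C x) x)\<bar>"
    by (simp add: cinner_simps hermitian_op_Im_cinner[OF assms] cinner_self abs_mult
        flip: of_real_power)
  also have "\<dots> \<le> cmod (cinner (blinfun_apply T x - z *\<^sub>C x) x)"
    by (rule abs_Im_le_cmod)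
  also have "\<dots> \<le> norm (blinfun_apply T x - z *\<^sub>C x) * norm x"
    by (rule cmod_cinner_le)
  finally show ?thesis
    using False by (simp add: power2_eq_square)
qed simp

text \<open>The lower bound makes the range complete, hence closed. By symmetry a vector orthogonal
  to the range is in the kernel, and the lower bound makes the kernel trivial.\<close>

lemma hermitian_op_bounded_below_surj:
  fixes T :: "'a::complex_hilbert \<Rightarrow>\<^sub>L 'a"
  assumes T: "hermitian_op T" and c: "0 < c" "\<And>x. c * norm x \<le> norm (blinfun_apply T x)"
  shows "surj (blinfun_apply T)"
proof -
  have "complete (range (blinfun_apply T))"
    by (rule complete_isometric_image[OF c(1)])
       (use c(2) in \<open>auto simp: blinfun.bounded_linear_right complete_UNIV\<close>)
  then have cl: "closed (range (blinfun_apply T))"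
    by (simp add: complete_eq_closed)
  have sub: "subspace (range (blinfun_apply T))"
    by (intro linear_subspace_image bounded_linear.linear blinfun.bounded_linear_right) auto
  have C: "c *\<^sub>C x \<in> range (blinfun_apply T)" if "x \<in> range (blinfun_apply T)" for c x
    using that bounded_ops_scaleC[OF hermitian_op_bounded_ops[OF T], symmetric] by auto
  have "y \<in> range (blinfun_apply T)" for y
  proof -
    obtain x where x: "\<And>v. cinner (y - blinfun_apply T x) (blinfun_apply T v) = 0"
      using orthogonal_projection_exists[OF sub cl C, of y] by auto
    \<comment> \<open>With \<open>u = y - T x\<close>, orthogonality to \<open>T (T u)\<close> and
      symmetry give \<open>cinner (T u) (T u) = 0\<close>.\<close>
    have "blinfun_apply T (y - blinfun_apply T x) = 0"
      using x[of "blinfun_apply T (y - blinfun_apply T x)"] T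
      by (metis cinner_self hermitian_opD norm_eq_zero of_real_eq_0_iff power_eq_0_iff)
    then have "y = blinfun_apply T x"
      using c(2)[of "y - blinfun_apply T x"] c(1) by (simp add: mult_le_0_iff)
    then show ?thesis
      by blast
  qed
  then show ?thesis
    by blast
qed

text \<open>A lower bound makes \<open>T - s\<close> injective and, by symmetry, onto. The inverse
  is complex-linear and bounded by \<open>1 / c\<close>, so it is a resolvent.\<close>

lemma hermitian_op_not_in_spectrum:
  fixes T :: "'a::complex_hilbert \<Rightarrow>\<^sub>L 'a"
  assumes T: "hermitian_op T"
    and c: "0 < c" "\<And>x. c * norm x \<le> norm (blinfun_apply T x - complex_of_real s *\<^sub>C x)"
  shows "s \<notin> real_spectrum T"
proof -
  define R where "R = T - s *\<^sub>R id_blinfun"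
  have R: "blinfun_apply R x = blinfun_apply T x - complex_of_real s *\<^sub>C x" for x
    by (simp add: R_def blinfun.diff_left blinfun.scaleR_left scaleR_scaleC)
  have hR: "hermitian_op R"
    unfolding R_def by (intro hermitian_op_diff hermitian_op_scaleR hermitian_op_id T)
  have "surj (blinfun_apply R)"
    using hermitian_op_bounded_below_surj[OF hR c(1)] c(2) by (simp add: R)
  moreover have inj: "x = y" if "blinfun_apply R x = blinfun_apply R y" for x y
  proof -
    have "c * norm (x - y) \<le> 0"
      using c(2)[of "x - y"] that by (simp only: flip: R) (simp add: blinfun.diff_right)
    then show ?thesis
      using c(1) by (simp add: mult_le_0_iff)
  qed
  ultimately obtain S where S: "\<And>x. blinfun_apply R (S x) = x" "\<And>x. S (blinfun_apply R x) = x"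
    by (metis surjD)
  have SC: "S (a *\<^sub>C x) = a *\<^sub>C S x" for a x
    by (rule inj) (simp add: S bounded_ops_scaleC[OF hermitian_op_bounded_ops[OF hR]])
  have "bounded_linear S"
  proof (rule bounded_linear_intro)
    show "S (x + y) = S x + S y" for x y
      by (rule inj) (simp add: S blinfun.add_right)
    show "S (r *\<^sub>R x) = r *\<^sub>R S x" for r x
      by (simp add: scaleR_scaleC SC)
    show "norm (S x) \<le> norm x * (1 / c)" for x
      using c(2)[of "S x"] c(1) by (simp add: S field_simps flip: R)
  qed
  then have "blinfun_apply (Blinfun S) = S"
    by (rule bounded_linear_Blinfun_apply)
  then have "Blinfun S \<in> bounded_ops \<and> (\<forall>x.
        blinfun_apply (Blinfun S) (blinfun_apply T x - complex_of_real s *\<^sub>C x) = x \<and>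
        blinfun_apply T (blinfun_apply (Blinfun S) x) - complex_of_real s *\<^sub>C blinfun_apply (Blinfun S) x = x)"
    using S by (simp add: bounded_ops_def SC flip: R)
  then show ?thesis
    by (auto simp: real_spectrum_def op_spectrum_def)
qed

lemma bounded_below_if_not_in_spectrum:
  fixes T :: "'a::complex_hilbert \<Rightarrow>\<^sub>L 'a"
  assumes "z \<notin> op_spectrum T"
  shows "bounded_below (\<lambda>x. blinfun_apply T x - z *\<^sub>C x)"
proof -
  obtain S where S: "\<And>x. blinfun_apply S (blinfun_apply T x - z *\<^sub>C x) = x"
    using assms by (auto simp: op_spectrum_def)
  \<comment> \<open>\<open>norm S\<close> vanishes on the zero space, so \<open>norm S + 1\<close>
    serves as the denominator.\<close>
  have "1 / (norm S + 1) * norm x \<le> norm (blinfun_apply T x - z *\<^sub>C x)" for x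
  proof -
    have "norm x \<le> norm S * norm (blinfun_apply T x - z *\<^sub>C x)"
      by (metis S norm_blinfun)
    also have "\<dots> \<le> (norm S + 1) * norm (blinfun_apply T x - z *\<^sub>C x)"
      by (intro mult_right_mono) auto
    finally show ?thesis
      by (subst times_divide_eq_left, subst pos_divide_le_eq) (simp_all add: add_nonneg_pos mult.commute)
  qed
  then show ?thesis
    unfolding bounded_below_def by (intro exI[of _ "1 / (norm S + 1)"]) (auto simp: add_nonneg_pos)
qed

text \<open>For \<open>s\<close> above the norm, the reverse triangle inequality gives
  \<open>T - s\<close> the lower bound \<open>s - norm T\<close>.\<close>

lemma real_spectrum_le_norm:
  assumes "hermitian_op T" "s \<in> real_spectrum T"
  shows "s \<le> norm T"
proof (rule ccontr)
  assume neg: "\<not> ?thesis"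
  have "(s - norm T) * norm x \<le> norm (blinfun_apply T x - complex_of_real s *\<^sub>C x)" for x
  proof -
    have "s * norm x - norm T * norm x \<le> norm (complex_of_real s *\<^sub>C x) - norm (blinfun_apply T x)"
      using norm_blinfun[of T x] abs_ge_self[of s] by (simp add: norm_scaleC add_mono diff_mono mult_right_mono)
    also have "\<dots> \<le> norm (blinfun_apply T x - complex_of_real s *\<^sub>C x)"
      by (metis norm_minus_commute norm_triangle_ineq2)
    finally show ?thesis
      by (simp add: algebra_simps)
  qed
  then show False
    using hermitian_op_not_in_spectrum[of T "s - norm T" s] assms neg by auto
qed

lemma real_spectrum_nonneg:
  assumes "hermitian_op T" "\<And>x. 0 \<le> Re (cinner (blinfun_apply T x) x)" "s \<in> real_spectrum T"
  shows "0 \<le> s"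
  using hermitian_op_not_in_spectrum[of T "- s" s] norm_shift_ge_Re[of s T] assms by force

section \<open>Polynomials of an operator, with real and with complex coefficients\<close>

lemma op_npow_0 [simp]: "op_npow T 0 = id_blinfun"
  by (simp add: op_npow_def)

lemma op_npow_Suc [simp]: "op_npow T (Suc n) = T o\<^sub>L op_npow T n"
  by (simp add: op_npow_def)

lemma op_poly_eq_sum:
  assumes "degree q \<le> n"
  shows "op_poly q T = (\<Sum>i\<le>n. coeff q i *\<^sub>R op_npow T i)"
  unfolding op_poly_def using assms
  by (intro sum.mono_neutral_left) (auto simp: coeff_eq_0)

lemma op_poly_0 [simp]: "op_poly 0 T = 0"
  by (simp add: op_poly_def)

lemma op_poly_pCons: "op_poly (pCons a q) T = a *\<^sub>R id_blinfun + (T o\<^sub>L op_poly q T)"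
proof -
  have "op_poly (pCons a q) T = (\<Sum>i\<le>Suc (degree q). coeff (pCons a q) i *\<^sub>R op_npow T i)"
    by (rule op_poly_eq_sum) (rule degree_pCons_le)
  also have "\<dots> = a *\<^sub>R id_blinfun + (\<Sum>i\<le>degree q. coeff q i *\<^sub>R (T o\<^sub>L op_npow T i))"
    by (simp add: sum.atMost_Suc_shift del: sum.atMost_Suc)
  also have "(\<Sum>i\<le>degree q. coeff q i *\<^sub>R (T o\<^sub>L op_npow T i)) = T o\<^sub>L op_poly q T"
    unfolding op_poly_def
    by (rule blinfun_eqI) (simp add: blinfun.sum_left blinfun.sum_right blinfun.scaleR_left blinfun.scaleR_right)
  finally show ?thesis .
qed

lemma op_poly_pCons_apply:
  "blinfun_apply (op_poly (pCons a q) T) x = a *\<^sub>R x + blinfun_apply T (blinfun_apply (op_poly q T) x)"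
  by (simp add: op_poly_pCons blinfun.add_left blinfun.scaleR_left)

lemma op_poly_add: "op_poly (p + q) T = op_poly p T + op_poly q T"
proof -
  define n where "n = max (degree p) (degree q)"
  have "degree (p + q) \<le> n" "degree p \<le> n" "degree q \<le> n"
    by (auto simp: n_def degree_add_le)
  then show ?thesis
    by (simp add: op_poly_eq_sum[of _ n] sum.distrib scaleR_left_distrib)
qed

lemma op_poly_smult: "op_poly (smult c p) T = c *\<^sub>R op_poly p T"
  by (simp add: op_poly_eq_sum[OF degree_smult_le] op_poly_def scaleR_sum_right)

lemma op_poly_diff: "op_poly (p - q) T = op_poly p T - op_poly q T"
  using op_poly_add[of "p - q" q T] by simp

lemma op_poly_mult: "op_poly (p * q) T = op_poly p T o\<^sub>L op_poly q T"
proof (induction p)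
  case (pCons a p)
  show ?case
    by (rule blinfun_eqI)
       (simp add: op_poly_add op_poly_smult pCons.IH op_poly_pCons_apply blinfun.add_left blinfun.scaleR_left)
qed simp

text \<open>An intertwining relation passes through each power of the operator. With
  \<open>A\<close>, \<open>T\<close> and \<open>S\<close> equal it says that \<open>T\<close>
  commutes with its polynomials; it also carries the calculus of \<open>A\<^sup>* A\<close> to that
  of \<open>A A\<^sup>*\<close>.\<close>

lemma op_poly_intertwine:
  assumes "\<And>x. blinfun_apply A (blinfun_apply T x) = blinfun_apply S (blinfun_apply A x)"
  shows "blinfun_apply A (blinfun_apply (op_poly q T) x) = blinfun_apply (op_poly q S) (blinfun_apply A x)"
  by (induction q) (simp_all add: op_poly_pCons_apply blinfun.add_right blinfun.scaleR_right assms)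

lemma hermitian_op_poly:
  assumes T: "hermitian_op T"
  shows "hermitian_op (op_poly q T)"
proof (induction q)
  case 0
  show ?case
    by (simp add: hermitian_op_def bounded_ops_def)
next
  case (pCons a q)
  \<comment> \<open>A product of two hermitian operators is hermitian because the factors
    commute.\<close>
  have "hermitian_op (T o\<^sub>L op_poly q T)"
    unfolding hermitian_op_def bounded_ops_def
    by (auto simp: hermitian_opD[OF T] hermitian_opD[OF pCons.IH] op_poly_intertwine[of T T T]
        bounded_ops_scaleC[OF hermitian_op_bounded_ops[OF T]]
        bounded_ops_scaleC[OF hermitian_op_bounded_ops[OF pCons.IH]])
  then show ?case
    by (simp add: op_poly_pCons hermitian_op_add hermitian_op_scaleR hermitian_op_id T)
qed

text \<open>Complex coefficients allow a splitting into linear factors. The result is kept as a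
  function of the vector because operators form a real vector space here.\<close>

definition cpoly_apply :: "complex poly \<Rightarrow> ('a::complex_hilbert \<Rightarrow>\<^sub>L 'a) \<Rightarrow> 'a \<Rightarrow> 'a"
  where "cpoly_apply p T x = (\<Sum>i\<le>degree p. coeff p i *\<^sub>C blinfun_apply (op_npow T i) x)"

lemma cpoly_apply_eq_sum:
  assumes "degree p \<le> n"
  shows "cpoly_apply p T x = (\<Sum>i\<le>n. coeff p i *\<^sub>C blinfun_apply (op_npow T i) x)"
  unfolding cpoly_apply_def using assms
  by (intro sum.mono_neutral_left) (auto simp: coeff_eq_0)

lemma cpoly_apply_pCons:
  assumes "T \<in> bounded_ops"
  shows "cpoly_apply (pCons a p) T x = a *\<^sub>C x + blinfun_apply T (cpoly_apply p T x)"
proof -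
  have "cpoly_apply (pCons a p) T x =
      (\<Sum>i\<le>Suc (degree p). coeff (pCons a p) i *\<^sub>C blinfun_apply (op_npow T i) x)"
    by (rule cpoly_apply_eq_sum) (rule degree_pCons_le)
  also have "\<dots> = a *\<^sub>C x + blinfun_apply T (cpoly_apply p T x)"
    by (simp add: sum.atMost_Suc_shift cpoly_apply_def blinfun.sum_right bounded_ops_scaleC[OF assms]
        del: sum.atMost_Suc)
  finally show ?thesis .
qed

lemma cpoly_apply_linear_factor:
  assumes "T \<in> bounded_ops"
  shows "cpoly_apply ([:- z, 1:] * p) T x = blinfun_apply T (cpoly_apply p T x) - z *\<^sub>C cpoly_apply p T x"
proof -
  let ?n = "Suc (degree p)"
  have "degree (pCons 0 p) \<le> ?n" "degree (smult z p) \<le> ?n" "degree p \<le> ?n"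
    using degree_smult_le[of z p] by (simp_all only: degree_pCons_le le_SucI order_refl)
  then have d: "degree (pCons 0 p - smult z p) \<le> ?n" "degree (pCons 0 p) \<le> ?n" "degree p \<le> ?n"
    by (auto intro!: degree_diff_le)
  have "[:- z, 1:] * p = pCons 0 p - smult z p"
    by simp
  then have "cpoly_apply ([:- z, 1:] * p) T x
      = (\<Sum>i\<le>?n. coeff (pCons 0 p - smult z p) i *\<^sub>C blinfun_apply (op_npow T i) x)"
    by (simp only: cpoly_apply_eq_sum[OF d(1)])
  also have "\<dots> = (\<Sum>i\<le>?n. coeff (pCons 0 p) i *\<^sub>C blinfun_apply (op_npow T i) x)
      - z *\<^sub>C (\<Sum>i\<le>?n. coeff p i *\<^sub>C blinfun_apply (op_npow T i) x)"
  proof -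
    have "(a - z * b) *\<^sub>C y = a *\<^sub>C y - z *\<^sub>C b *\<^sub>C y" for a b and y :: 'a
      using scaleC_add_left[of "a - z * b" "z * b" y] by (simp add: scaleC_scaleC)
    then show ?thesis
      unfolding scaleC_sum_right sum_subtractf[symmetric] coeff_diff coeff_smult by simp
  qed
  also have "\<dots> = cpoly_apply (pCons 0 p) T x - z *\<^sub>C cpoly_apply p T x"
    by (simp only: cpoly_apply_eq_sum[OF d(2)] cpoly_apply_eq_sum[OF d(3)])
  finally show ?thesis
    by (simp add: cpoly_apply_pCons[OF assms])
qed

lemma cpoly_apply_of_real:
  assumes "T \<in> bounded_ops"
  shows "cpoly_apply (map_poly complex_of_real q) T x = blinfun_apply (op_poly q T) x"
proof (induction q)
  case 0
  then show ?case
    by (simp add: cpoly_apply_def)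
next
  case (pCons a q)
  then show ?case
    by (simp add: map_poly_pCons cpoly_apply_pCons assms op_poly_pCons_apply scaleR_scaleC)
qed

lemma bounded_below_compose:
  assumes "bounded_below f" "bounded_below g"
  shows "bounded_below (\<lambda>x. f (g x))"
proof -
  obtain c d where "0 < c" "\<And>x. c * norm x \<le> norm (f x)" "0 < d" "\<And>x. d * norm x \<le> norm (g x)"
    using assms by (auto simp: bounded_below_def)
  moreover from this have "c * d * norm x \<le> norm (f (g x))" for x
    by (metis mult.assoc mult_left_mono less_imp_le order_trans)
  ultimately show ?thesis
    unfolding bounded_below_def by (intro exI[of _ "c * d"]) auto
qed

text \<open>By the fundamental theorem of algebra the polynomial is a nonzero constant times factors
  \<open>T - z\<close> over its roots, and composition preserves being bounded below.\<close>

lemma bounded_below_cpoly_apply: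
  assumes T: "T \<in> bounded_ops" and "p \<noteq> 0"
    and "\<And>z. poly p z = 0 \<Longrightarrow> bounded_below (\<lambda>x. blinfun_apply T x - z *\<^sub>C x)"
  shows "bounded_below (cpoly_apply p T)"
  using assms(2,3)
proof (induction "degree p" arbitrary: p)
  case 0
  then obtain a where p: "p = [:a:]"
    by (metis degree_eq_zeroE)
  with 0 show ?case
    by (auto simp: bounded_below_def cpoly_apply_def norm_scaleC intro!: exI[of _ "cmod a"])
next
  case (Suc n)
  obtain z where z: "poly p z = 0"
    using Suc.hyps fundamental_theorem_of_algebra[of p] constant_degree[of p] by auto
  then obtain q where q: "p = [:- z, 1:] * q"
    by (metis dvdE poly_eq_0_iff_dvd)
  have "degree p = Suc (degree q)"
    using Suc.prems(1) unfolding q by (subst degree_mult_eq) auto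
  then have "bounded_below (cpoly_apply q T)"
    using Suc by (intro Suc.hyps(1)) (auto simp: q)
  then have "bounded_below (\<lambda>x. blinfun_apply T (cpoly_apply q T x) - z *\<^sub>C cpoly_apply q T x)"
    by (rule bounded_below_compose[OF Suc.prems(2)[OF z]])
  then show ?case
    unfolding q cpoly_apply_linear_factor[OF T, abs_def] .
qed

section \<open>Spectral values and the norm of a polynomial of a hermitian operator\<close>

lemma poly_map_poly_of_real:
  "poly (map_poly complex_of_real q) (complex_of_real s) = complex_of_real (poly q s)"
  by (induction q) (simp_all add: map_poly_pCons)

text \<open>If \<open>p(T)\<close> is not bounded below, then neither is \<open>T - z\<close> for
  some complex root \<open>z\<close> of \<open>p\<close>. Hermiticity makes \<open>z\<close> real,
  and a point outside the spectrum would give a lower bound.\<close>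

lemma real_spectrum_root:
  fixes T :: "'a::complex_hilbert \<Rightarrow>\<^sub>L 'a"
  assumes T: "hermitian_op T" and p: "p \<noteq> 0" and nbb: "\<not> bounded_below (blinfun_apply (op_poly p T))"
  shows "\<exists>s\<in>real_spectrum T. poly p s = 0"
proof -
  note T' = hermitian_op_bounded_ops[OF T]
  let ?p = "map_poly complex_of_real p"
  have "?p \<noteq> 0"
    using p by (metis map_poly_0 map_poly_eq_0_iff of_real_0 of_real_eq_0_iff)
  moreover have "\<not> bounded_below (cpoly_apply ?p T)"
    using nbb by (simp add: cpoly_apply_of_real[OF T', abs_def])
  ultimately obtain z where z: "poly ?p z = 0" "\<not> bounded_below (\<lambda>x. blinfun_apply T x - z *\<^sub>C x)"
    using bounded_below_cpoly_apply[OF T'] by blast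
  have "Im z = 0"
    using z(2) hermitian_op_norm_shift_ge_Im[OF T, of z] unfolding bounded_below_def
    by (metis zero_less_abs_iff)
  then have zr: "z = complex_of_real (Re z)"
    by (simp add: complex_eq_iff)
  then have "poly p (Re z) = 0"
    using z(1) by (metis of_real_eq_0_iff poly_map_poly_of_real)
  moreover have "Re z \<in> real_spectrum T"
    using zr z(2) bounded_below_if_not_in_spectrum[of z T] by (auto simp: real_spectrum_def)
  ultimately show ?thesis
    by blast
qed

text \<open>With \<open>N = norm S\<close>, a lower bound \<open>c\<close> would improve the
  estimate of the squared norm of \<open>S x\<close> from the factor \<open>N\<^sup>2\<close> to
  \<open>N\<^sup>2 - c\<^sup>2 / N\<^sup>2\<close>, contradicting the definition of
  \<open>N\<close>. A nonzero vector is required because on the zero space every map is bounded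
  below.\<close>

lemma hermitian_op_not_bounded_below_norm_sq:
  fixes S :: "'a::complex_hilbert \<Rightarrow>\<^sub>L 'a"
  assumes S: "hermitian_op S" and nt: "\<exists>x::'a. x \<noteq> 0"
  shows "\<not> bounded_below (\<lambda>x. blinfun_apply S (blinfun_apply S x) - (norm S)\<^sup>2 *\<^sub>R x)"
proof
  assume "bounded_below (\<lambda>x. blinfun_apply S (blinfun_apply S x) - (norm S)\<^sup>2 *\<^sub>R x)"
  then obtain c where c: "0 < c"
      "\<And>x. c * norm x \<le> norm (blinfun_apply S (blinfun_apply S x) - (norm S)\<^sup>2 *\<^sub>R x)"
    by (auto simp: bounded_below_def)
  define N where "N = norm S"
  have N: "0 < N"
  proof (rule ccontr)
    assume "\<not> 0 < N"
    then have "S = 0"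
      by (simp add: N_def)
    then show False
      using c nt by (auto simp: mult_le_0_iff not_less)
  qed
  \<comment> \<open>The maximum with \<open>0\<close> keeps the square root meaningful; in either
    case \<open>k < N\<^sup>2\<close>, which is the contradiction sought.\<close>
  define k where "k = max 0 (N\<^sup>2 - c\<^sup>2 / N\<^sup>2)"
  have bound: "norm (blinfun_apply S x) \<le> sqrt k * norm x" for x
  proof -
    have le: "(norm (blinfun_apply S (blinfun_apply S x)))\<^sup>2 \<le> (N * norm (blinfun_apply S x))\<^sup>2"
      unfolding N_def by (intro power_mono norm_blinfun) auto
    have "(c * norm x)\<^sup>2 \<le> (norm (blinfun_apply S (blinfun_apply S x) - N\<^sup>2 *\<^sub>R x))\<^sup>2"
      using c by (intro power_mono) (auto simp: N_def)
    also have "\<dots> = (norm (blinfun_apply S (blinfun_apply S x)))\<^sup>2 - 2 * N\<^sup>2 * (norm (blinfun_apply S x))\<^sup>2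
        + (N\<^sup>2)\<^sup>2 * (norm x)\<^sup>2"
    proof -
      have "Re (cinner (blinfun_apply S (blinfun_apply S x)) x) = (norm (blinfun_apply S x))\<^sup>2"
        by (simp only: hermitian_opD[OF S, of "blinfun_apply S x"] Re_cinner_self)
      then show ?thesis
        by (simp add: norm_diff_sq cinner_scaleR_right power_mult_distrib)
    qed
    also have "\<dots> \<le> N\<^sup>2 * (N\<^sup>2 * (norm x)\<^sup>2 - (norm (blinfun_apply S x))\<^sup>2)"
      using le by (simp add: power_mult_distrib power2_eq_square algebra_simps)
    finally have "(norm (blinfun_apply S x))\<^sup>2 \<le> (N\<^sup>2 - c\<^sup>2 / N\<^sup>2) * (norm x)\<^sup>2"
      using N by (simp add: field_simps power_mult_distrib)
    also have "\<dots> \<le> k * (norm x)\<^sup>2"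
      by (intro mult_right_mono) (auto simp: k_def)
    finally have "sqrt ((norm (blinfun_apply S x))\<^sup>2) \<le> sqrt (k * (norm x)\<^sup>2)"
      by (rule real_sqrt_le_mono)
    then show ?thesis
      by (simp add: real_sqrt_mult)
  qed
  have "N \<le> sqrt k"
    unfolding N_def by (rule norm_blinfun_bound) (use bound in \<open>auto simp: k_def\<close>)
  then have "N\<^sup>2 \<le> k"
    using power_mono[of N "sqrt k" 2] N by (simp add: k_def)
  moreover have "0 < c\<^sup>2 / N\<^sup>2" "0 < N\<^sup>2"
    using N c by auto
  ultimately show False
    by (auto simp: k_def max_def split: if_splits)
qed

text \<open>The preceding lemma for \<open>q(T)\<close> shows that \<open>g q\<close> evaluated at
  \<open>T\<close> is not bounded below, so \<open>g q\<close> has a root in the spectrum. At that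
  root the square of \<open>q\<close> equals the squared norm of \<open>q(T)\<close>.\<close>

lemma real_spectrum_norm_attained:
  fixes T :: "'a::complex_hilbert \<Rightarrow>\<^sub>L 'a"
  assumes T: "hermitian_op T" and nt: "\<exists>x::'a. x \<noteq> 0"
  shows "\<exists>s\<in>real_spectrum T. norm (op_poly q T) = \<bar>poly q s\<bar>"
proof -
  define g where "g p = p * p - [:(norm (op_poly p T))\<^sup>2:]" for p
  have app: "blinfun_apply (op_poly (g p) T) = (\<lambda>x. blinfun_apply (op_poly p T) (blinfun_apply (op_poly p T) x)
      - (norm (op_poly p T))\<^sup>2 *\<^sub>R x)" for p
    by (simp add: fun_eq_iff g_def op_poly_diff op_poly_mult blinfun.diff_left op_poly_pCons_apply)
  have nbb: "\<not> bounded_below (blinfun_apply (op_poly (g p) T))" for p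
    unfolding app by (intro hermitian_op_not_bounded_below_norm_sq hermitian_op_poly T nt)
  have "\<exists>s\<in>real_spectrum T. poly (g q) s = 0"
  \<comment> \<open>If \<open>g q\<close> is the zero polynomial, any spectral point will do; one
    exists because \<open>g [:0, 1:]\<close> is monic of degree two and hence has a root in the
    spectrum.\<close>
  proof (cases "g q = 0")
    case True
    have "g [:0, 1:] \<noteq> 0"
      by (simp add: g_def)
    then have "real_spectrum T \<noteq> {}"
      using real_spectrum_root[OF T _ nbb] by blast
    then show ?thesis
      using True by auto
  qed (use real_spectrum_root[OF T _ nbb] in blast)
  then obtain s where s: "s \<in> real_spectrum T" "(norm (op_poly q T))\<^sup>2 = (poly q s)\<^sup>2"
    by (auto simp: g_def power2_eq_square)
  then have "norm (op_poly q T) = \<bar>poly q s\<bar>"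
    by (metis abs_norm_cancel power2_eq_iff abs_minus_cancel)
  with s(1) show ?thesis
    by blast
qed

text \<open>On the zero space the spectrum is empty and says nothing about \<open>e\<close>, hence
  the assumption \<open>0 \<le> e\<close>.\<close>

lemma norm_op_poly_le:
  fixes T :: "'a::complex_hilbert \<Rightarrow>\<^sub>L 'a"
  assumes "hermitian_op T" "0 \<le> e" "\<And>s. s \<in> real_spectrum T \<Longrightarrow> \<bar>poly q s\<bar> \<le> e"
  shows "norm (op_poly q T) \<le> e"
proof (cases "\<exists>x::'a. x \<noteq> 0")
  case True
  then show ?thesis
    using real_spectrum_norm_attained[OF assms(1)] assms(3) by metis
next
  case False
  then have "op_poly q T = 0"
    by (metis blinfun_eqI)
  then show ?thesis
    using assms(2) by simp
qed

section \<open>Continuous functional calculus\<close>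

text \<open>A compact superset \<open>K\<close> takes the place of the spectrum: it can be an
  interval, and two operators can share it.\<close>

locale hermitian_calculus =
  fixes T :: "'a::complex_hilbert \<Rightarrow>\<^sub>L 'a" and K :: "real set"
  assumes herm: "hermitian_op T"
    and compact: "compact K"
    and spectrum: "real_spectrum T \<subseteq> K"
begin

lemma ex_polynomial_limit:
  assumes "continuous_on K f"
  shows "\<exists>q. uniform_limit K (\<lambda>n. poly (q n)) f sequentially"
proof -
  obtain g where g: "uniform_limit K g f sequentially" "\<And>n. polynomial_function (g n)"
    using Stone_Weierstrass_uniform_limit[OF compact assms] by blast
  have "\<exists>q. g n = poly q" for n
  proof -
    obtain a m where "g n = (\<lambda>x. \<Sum>i\<le>m. a i * x ^ i)"
      using g(2)[of n] by (auto simp flip: real_polynomial_function_eq simp: real_polynomial_function_iff_sum)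
    then show ?thesis
      by (intro exI[of _ "\<Sum>i\<le>m. monom (a i) i"]) (simp add: fun_eq_iff poly_sum poly_monom)
  qed
  then obtain q where "\<And>n. g n = poly (q n)"
    by metis
  then have "g = (\<lambda>n. poly (q n))"
    by (rule ext)
  then show ?thesis
    using g(1) by blast
qed

text \<open>Two approximating sequences are compared at once: \<open>p = q\<close> yields the Cauchy
  property, and different sequences yield independence of the limit.\<close>

lemma op_poly_diff_small:
  assumes p: "uniform_limit (real_spectrum T) (\<lambda>n. poly (p n)) f sequentially"
    and q: "uniform_limit (real_spectrum T) (\<lambda>n. poly (q n)) f sequentially"
    and e: "0 < e"
  shows "\<exists>N. \<forall>m\<ge>N. \<forall>n\<ge>N. norm (op_poly (p m) T - op_poly (q n) T) < e"
proof -
  \<comment> \<open>Two errors below \<open>e / 4\<close> bound the polynomial difference by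
    \<open>e / 2\<close>; the slack restores the strict inequality lost in the norm
    estimate.\<close>
  from e have "0 < e / 4"
    by simp
  from uniform_limitD[OF p this] uniform_limitD[OF q this]
  have "\<forall>\<^sub>F n in sequentially. (\<forall>s\<in>real_spectrum T. dist (poly (p n) s) (f s) < e / 4) \<and>
      (\<forall>s\<in>real_spectrum T. dist (poly (q n) s) (f s) < e / 4)"
    by (rule eventually_conj)
  then obtain N where N: "\<And>n s. n \<ge> N \<Longrightarrow> s \<in> real_spectrum T \<Longrightarrow> dist (poly (p n) s) (f s) < e / 4"
      "\<And>n s. n \<ge> N \<Longrightarrow> s \<in> real_spectrum T \<Longrightarrow> dist (poly (q n) s) (f s) < e / 4"
    by (auto simp: eventually_sequentially)
  have "norm (op_poly (p m) T - op_poly (q n) T) < e" if "m \<ge> N" "n \<ge> N" for m n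
  proof -
    have "norm (op_poly (p m - q n) T) \<le> e / 2"
    proof (rule norm_op_poly_le[OF herm])
      show "\<bar>poly (p m - q n) s\<bar> \<le> e / 2" if "s \<in> real_spectrum T" for s
        using N(1)[OF \<open>m \<ge> N\<close> that] N(2)[OF \<open>n \<ge> N\<close> that]
        unfolding dist_real_def poly_diff by linarith
    qed (use e in simp)
    then show ?thesis
      using e by (simp add: op_poly_diff)
  qed
  then show ?thesis
    by blast
qed

text \<open>Completeness of the operator space provides a limit, and every other approximating
  sequence has the same one. The given \<open>q\<close> keeps the defining condition of
  \<open>op_fun\<close> from being vacuous, so its value is unique.\<close>

lemma tendsto_op_fun:
  assumes lim: "uniform_limit K (\<lambda>n. poly (q n)) f sequentially"
  shows "(\<lambda>n. op_poly (q n) T) \<longlonglongrightarrow> op_fun f T"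
proof -
  let ?\<Sigma> = "real_spectrum T"
  have q: "uniform_limit ?\<Sigma> (\<lambda>n. poly (q n)) f sequentially"
    using lim spectrum by (rule uniform_limit_on_subset)
  have "Cauchy (\<lambda>n. op_poly (q n) T)"
    unfolding Cauchy_def dist_norm using op_poly_diff_small[OF q q] by blast
  then obtain S where S: "(\<lambda>n. op_poly (q n) T) \<longlonglongrightarrow> S"
    using Cauchy_convergent convergent_def by blast
  have other: "(\<lambda>n. op_poly (p n) T) \<longlonglongrightarrow> S"
    if p: "uniform_limit ?\<Sigma> (\<lambda>n. poly (p n)) f sequentially" for p
  proof -
    have "(\<lambda>n. op_poly (p n) T - op_poly (q n) T) \<longlonglongrightarrow> 0"
      using op_poly_diff_small[OF p q] by (intro LIMSEQ_I) (auto, meson)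
    from tendsto_add[OF this S] show ?thesis
      by simp
  qed
  have "op_fun f T = S"
    unfolding op_fun_def real_spectrum_def[symmetric]
  proof (rule the_equality)
    show "S' = S" if "\<forall>p. uniform_limit ?\<Sigma> (\<lambda>n. poly (p n)) f sequentially \<longrightarrow>
        (\<lambda>n. op_poly (p n) T) \<longlonglongrightarrow> S'" for S'
      using that q S LIMSEQ_unique by blast
  qed (use other in blast)
  with S show ?thesis
    by simp
qed

lemma op_fun_cong:
  assumes "\<And>s. s \<in> K \<Longrightarrow> f s = g s"
  shows "op_fun f T = op_fun g T"
proof -
  have "uniform_limit (real_spectrum T) q f sequentially \<longleftrightarrow> uniform_limit (real_spectrum T) q g sequentially" for q
    using assms spectrum by (intro uniform_limit_cong') auto
  then show ?thesis
    unfolding op_fun_def real_spectrum_def[symmetric] by simp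
qed

lemma op_fun_const: "op_fun (\<lambda>_. c) T = c *\<^sub>R id_blinfun"
proof -
  have "uniform_limit K (\<lambda>n. poly [:c:]) (\<lambda>_. c) sequentially"
    by (auto intro!: uniform_limitI)
  from tendsto_op_fun[OF this] show ?thesis
    by (simp add: op_poly_pCons LIMSEQ_const_iff)
qed

lemma op_fun_ident: "op_fun (\<lambda>s. s) T = T"
proof -
  have "uniform_limit K (\<lambda>n. poly [:0, 1:]) (\<lambda>s. s) sequentially"
    by (auto intro!: uniform_limitI)
  from tendsto_op_fun[OF this] have "op_fun (\<lambda>s. s) T = op_poly [:0, 1:] T"
    by (simp add: LIMSEQ_const_iff)
  also have "\<dots> = T"
    by (rule blinfun_eqI) (simp add: op_poly_pCons_apply)
  finally show ?thesis .
qed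

lemma op_fun_add:
  assumes "continuous_on K f" "continuous_on K g"
  shows "op_fun (\<lambda>s. f s + g s) T = op_fun f T + op_fun g T"
proof -
  obtain p q where p: "uniform_limit K (\<lambda>n. poly (p n)) f sequentially"
    and q: "uniform_limit K (\<lambda>n. poly (q n)) g sequentially"
    using ex_polynomial_limit assms by metis
  have "uniform_limit K (\<lambda>n. poly (p n + q n)) (\<lambda>s. f s + g s) sequentially"
    using uniform_limit_add[OF p q] by (simp only: poly_add[abs_def])
  from tendsto_op_fun[OF this] tendsto_add[OF tendsto_op_fun[OF p] tendsto_op_fun[OF q]]
  show ?thesis
    by (simp add: op_poly_add LIMSEQ_unique)
qed

lemma op_fun_mult:
  assumes "continuous_on K f" "continuous_on K g"
  shows "op_fun (\<lambda>s. f s * g s) T = op_fun f T o\<^sub>L op_fun g T"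
proof -
  obtain p q where p: "uniform_limit K (\<lambda>n. poly (p n)) f sequentially"
    and q: "uniform_limit K (\<lambda>n. poly (q n)) g sequentially"
    using ex_polynomial_limit assms by metis
  \<comment> \<open>Uniform limits multiply here because \<open>f\<close> and \<open>g\<close> are
    bounded on the compact set \<open>K\<close>.\<close>
  have "uniform_limit K (\<lambda>n. poly (p n * q n)) (\<lambda>s. f s * g s) sequentially"
    unfolding poly_mult[abs_def]
    by (intro uniform_lim_mult p q compact_imp_bounded compact_continuous_image assms compact)
  from tendsto_op_fun[OF this]
    bounded_bilinear.tendsto[OF bounded_bilinear_blinfun_compose tendsto_op_fun[OF p] tendsto_op_fun[OF q]]
  show ?thesis
    by (simp add: op_poly_mult LIMSEQ_unique)
qed

lemma op_fun_scale:
  assumes "continuous_on K f"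
  shows "op_fun (\<lambda>s. c * f s) T = c *\<^sub>R op_fun f T"
proof -
  have "op_fun (\<lambda>s. c * f s) T = (c *\<^sub>R id_blinfun) o\<^sub>L op_fun f T"
    using op_fun_mult[of "\<lambda>_. c" f] assms by (simp add: op_fun_const)
  also have "\<dots> = c *\<^sub>R op_fun f T"
    by (rule blinfun_eqI) (simp add: blinfun.scaleR_left)
  finally show ?thesis .
qed

lemma hermitian_op_fun:
  assumes "continuous_on K f"
  shows "hermitian_op (op_fun f T)"
proof -
  obtain q where "uniform_limit K (\<lambda>n. poly (q n)) f sequentially"
    using ex_polynomial_limit assms by blast
  then show ?thesis
    using hermitian_op_limit[OF hermitian_op_poly[OF herm] tendsto_op_fun] by blast
qed

lemma cinner_op_fun_mult:
  assumes "continuous_on K f" "continuous_on K g"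
  shows "cinner (blinfun_apply (op_fun (\<lambda>s. f s * g s) T) x) y
       = cinner (blinfun_apply (op_fun g T) x) (blinfun_apply (op_fun f T) y)"
  using assms by (simp add: op_fun_mult hermitian_opD[OF hermitian_op_fun])

text \<open>Since \<open>f\<close> is the square of its root on \<open>K\<close>, the form of
  \<open>f(T)\<close> at \<open>x\<close> is the squared norm of the root of \<open>f\<close>, taken
  at \<open>T\<close>, applied to \<open>x\<close>.\<close>

lemma op_fun_nonneg:
  assumes f: "continuous_on K f" and nn: "\<And>s. s \<in> K \<Longrightarrow> 0 \<le> f s"
  shows "0 \<le> Re (cinner (blinfun_apply (op_fun f T) x) x)"
proof -
  have "continuous_on K (\<lambda>s. sqrt (f s))"
    by (intro continuous_intros f)
  moreover have "op_fun f T = op_fun (\<lambda>s. sqrt (f s) * sqrt (f s)) T"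
    by (rule op_fun_cong) (simp add: nn)
  ultimately show ?thesis
    by (simp only: cinner_op_fun_mult Re_cinner_self zero_le_power2)
qed

lemma op_fun_mono:
  assumes f: "continuous_on K f" and g: "continuous_on K g" and le: "\<And>s. s \<in> K \<Longrightarrow> f s \<le> g s"
  shows "Re (cinner (blinfun_apply (op_fun f T) x) x) \<le> Re (cinner (blinfun_apply (op_fun g T) x) x)"
proof -
  have c: "continuous_on K (\<lambda>s. g s - f s)"
    by (intro continuous_intros f g)
  have "op_fun g T = op_fun f T + op_fun (\<lambda>s. g s - f s) T"
    using op_fun_add[OF f c] by simp
  moreover have "0 \<le> Re (cinner (blinfun_apply (op_fun (\<lambda>s. g s - f s) T) x) x)"
    by (rule op_fun_nonneg[OF c]) (use le in auto)
  ultimately show ?thesis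
    by (simp add: blinfun.add_left cinner_simps)
qed

end

text \<open>One polynomial sequence approximates \<open>f\<close> for both operators because they
  share \<open>K\<close>; the polynomial identity then passes to the limit.\<close>

lemma op_fun_intertwine:
  assumes T: "hermitian_calculus T K" and S: "hermitian_calculus S K"
    and A: "\<And>x. blinfun_apply A (blinfun_apply T x) = blinfun_apply S (blinfun_apply A x)"
    and f: "continuous_on K f"
  shows "blinfun_apply A (blinfun_apply (op_fun f T) x) = blinfun_apply (op_fun f S) (blinfun_apply A x)"
proof -
  obtain q where q: "uniform_limit K (\<lambda>n. poly (q n)) f sequentially"
    using hermitian_calculus.ex_polynomial_limit[OF T f] by blast
  have "(\<lambda>n. blinfun_apply A (blinfun_apply (op_poly (q n) T) x)) \<longlonglongrightarrow> blinfun_apply A (blinfun_apply (op_fun f T) x)"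
    by (intro tendsto_intros hermitian_calculus.tendsto_op_fun[OF T q])
  moreover have "(\<lambda>n. blinfun_apply (op_poly (q n) S) (blinfun_apply A x)) \<longlonglongrightarrow> blinfun_apply (op_fun f S) (blinfun_apply A x)"
    by (intro tendsto_intros hermitian_calculus.tendsto_op_fun[OF S q])
  ultimately show ?thesis
    by (simp add: op_poly_intertwine[OF A] LIMSEQ_unique)
qed

section \<open>Positive operators, real powers and McCarthy's inequality\<close>

definition positive_op :: "('a::complex_hilbert \<Rightarrow>\<^sub>L 'a) \<Rightarrow> bool"
  where "positive_op T \<longleftrightarrow> hermitian_op T \<and> (\<forall>x. 0 \<le> Re (cinner (blinfun_apply T x) x))"

lemma positive_op_calculus:
  assumes "positive_op T" "norm T \<le> M"
  shows "hermitian_calculus T {0..M}"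
  using assms real_spectrum_nonneg[of T] real_spectrum_le_norm[of T]
  by unfold_locales (auto simp: positive_op_def subset_iff intro: order_trans)

lemma continuous_on_powr_const [continuous_intros]:
  fixes a :: real
  assumes "0 < a" "continuous_on S f" "\<And>x. x \<in> S \<Longrightarrow> 0 \<le> f x"
  shows "continuous_on S (\<lambda>x. f x powr a)"
  using assms by (intro continuous_on_powr') auto

lemma positive_op_powr:
  assumes "positive_op T" "0 < a"
  shows "positive_op (op_powr T a)"
proof -
  interpret hermitian_calculus T "{0..norm T}"
    by (rule positive_op_calculus) (use assms in auto)
  show ?thesis
    unfolding positive_op_def op_powr_def
    by (intro conjI allI hermitian_op_fun op_fun_nonneg continuous_intros) (use assms in auto)
qed

lemma op_powr_add:
  assumes "positive_op T" "0 < a" "0 < b"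
  shows "op_powr T (a + b) = op_powr T a o\<^sub>L op_powr T b"
proof -
  interpret hermitian_calculus T "{0..norm T}"
    by (rule positive_op_calculus) (use assms in auto)
  show ?thesis
    unfolding op_powr_def using assms
    by (simp add: powr_add) (intro op_fun_mult continuous_intros, auto)
qed

lemma op_powr_one:
  assumes "positive_op T"
  shows "op_powr T 1 = T"
proof -
  interpret hermitian_calculus T "{0..norm T}"
    by (rule positive_op_calculus) (use assms in auto)
  have "op_fun (\<lambda>s. s powr 1) T = op_fun (\<lambda>s. s) T"
    by (rule op_fun_cong) auto
  then show ?thesis
    by (simp add: op_powr_def op_fun_ident)
qed

text \<open>The graph of a convex function lies above its tangents. At the boundary point
  \<open>v = 0\<close> a direct computation reduces the claim to
  \<open>(1 - p) * u powr p \<le> 0\<close>.\<close>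

lemma powr_above_tangent:
  fixes u v p :: real
  assumes "0 < u" "0 \<le> v" "1 \<le> p"
  shows "u powr p + p * u powr (p - 1) * (v - u) \<le> v powr p"
proof (cases "v = 0")
  case True
  have "u powr (p - 1) * u = u powr p"
    using assms powr_mult_base[of u "p - 1"] by (simp add: mult.commute)
  then have "u powr p + p * u powr (p - 1) * (v - u) = (1 - p) * u powr p"
    using True by (simp add: algebra_simps)
  also have "\<dots> \<le> 0"
    using assms by (simp add: mult_nonpos_nonneg)
  finally show ?thesis
    using True by simp
next
  case False
  have "p * u powr (p - 1) * (v - u) \<le> v powr p - u powr p"
    by (rule convex_on_imp_above_tangent[OF powr_convex[OF assms(3)]])
       (use assms False in \<open>auto intro!: derivative_eq_intros simp: interior_open\<close>)
  then show ?thesis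
    by simp
qed

text \<open>Jensen's inequality: insert \<open>s powr a\<close> into the tangent of the
  \<open>p\<close>-th power at the mean value \<open>u\<close> and apply the monotone calculus. The
  inner exponent \<open>a\<close> is later \<open>2\<close> for \<open>norm (A x)\<close> and
  \<open>1\<close> for the mixed Schwarz bound.\<close>

lemma mccarthy:
  assumes T: "positive_op T" and a: "0 < a" and p: "1 \<le> p" and x: "norm x = 1"
  shows "Re (cinner (blinfun_apply (op_powr T a) x) x) powr p
       \<le> Re (cinner (blinfun_apply (op_powr T (a * p)) x) x)"
proof -
  interpret hermitian_calculus T "{0..norm T}"
    by (rule positive_op_calculus) (use assms in auto)
  define u where "u = Re (cinner (blinfun_apply (op_powr T a) x) x)"
  have nn: "0 \<le> Re (cinner (blinfun_apply (op_powr T b) x) x)" if "0 < b" for b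
    using positive_op_powr[OF T that] by (simp add: positive_op_def)
  show ?thesis
  proof (cases "u = 0")
    case True
    then show ?thesis
      using nn[of "a * p"] a p by (simp add: u_def)
  next
    case False
    then have u: "0 < u"
      using nn[OF a] by (simp add: u_def)
    define k where "k = p * u powr (p - 1)"
    have c: "continuous_on {0..norm T} (\<lambda>s. s powr a)" "continuous_on {0..norm T} (\<lambda>s. s powr (a * p))"
      using a p by (auto intro!: continuous_intros)
    \<comment> \<open>The form of this affine expression at the unit vector \<open>x\<close> is
      exactly \<open>u powr p\<close>, because the terms \<open>k * u\<close> cancel.\<close>
    have "op_fun (\<lambda>s. (u powr p - k * u) + k * s powr a) T
        = (u powr p - k * u) *\<^sub>R id_blinfun + k *\<^sub>R op_powr T a"
      unfolding op_powr_def
      using op_fun_add[of "\<lambda>_. u powr p - k * u" "\<lambda>s. k * s powr a"] c(1)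
      by (simp add: op_fun_scale op_fun_const continuous_on_mult_left)
    then have "Re (cinner (blinfun_apply (op_fun (\<lambda>s. (u powr p - k * u) + k * s powr a) T) x) x) = u powr p"
      by (simp add: blinfun.add_left blinfun.scaleR_left cinner_simps Re_cinner_self x flip: u_def)
    moreover have "(u powr p - k * u) + k * s powr a \<le> s powr (a * p)" if "s \<in> {0..norm T}" for s
      using powr_above_tangent[OF u, of "s powr a" p] p that
      by (simp add: k_def powr_powr algebra_simps)
    then have "Re (cinner (blinfun_apply (op_fun (\<lambda>s. (u powr p - k * u) + k * s powr a) T) x) x)
        \<le> Re (cinner (blinfun_apply (op_powr T (a * p)) x) x)"
      unfolding op_powr_def
      by (intro op_fun_mono continuous_on_add continuous_on_mult_left continuous_on_const c)
    ultimately show ?thesis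
      by (simp add: u_def)
  qed
qed

section \<open>Mixed Schwarz inequality\<close>

lemma cinner_adjoint_compose:
  assumes "A \<in> bounded_ops"
  shows "cinner (blinfun_apply (op_adjoint A o\<^sub>L A) x) y = cinner (blinfun_apply A x) (blinfun_apply A y)"
  by (simp add: cinner_op_adjoint'[OF assms])

lemma positive_op_adjoint_compose:
  assumes A: "A \<in> bounded_ops"
  shows "positive_op (op_adjoint A o\<^sub>L A)"
  using op_adjoint_bounded_ops[OF A] A
  by (simp add: positive_op_def hermitian_op_def bounded_ops_def cinner_op_adjoint'[OF A]
      flip: cinner_op_adjoint[OF A]) (simp add: Re_cinner_self)

lemma positive_op_abs: "A \<in> bounded_ops \<Longrightarrow> positive_op (op_abs A)"
  unfolding op_abs_def by (intro positive_op_powr positive_op_adjoint_compose) auto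

lemma op_powr_abs_2:
  assumes A: "A \<in> bounded_ops"
  shows "op_powr (op_abs A) 2 = op_adjoint A o\<^sub>L A"
proof -
  have "op_powr (op_abs A) 2 = op_abs A o\<^sub>L op_abs A"
    using op_powr_add[OF positive_op_abs[OF A], of 1 1]
    by (simp add: op_powr_one[OF positive_op_abs[OF A]])
  also have "\<dots> = op_adjoint A o\<^sub>L A"
    using op_powr_add[OF positive_op_adjoint_compose[OF A], of "1/2" "1/2"]
    by (simp add: op_abs_def op_powr_one[OF positive_op_adjoint_compose[OF A]])
  finally show ?thesis .
qed

text \<open>The square of \<open>op_abs A\<close> is \<open>A\<^sup>* A\<close>, whose form at
  \<open>x\<close> is the squared norm of \<open>A x\<close>; McCarthy's inequality raises this to
  the power \<open>p\<close>.\<close>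

lemma norm_powr_le_op_abs:
  assumes A: "A \<in> bounded_ops" and p: "1 \<le> p" and x: "norm x = 1"
  shows "norm (blinfun_apply A x) powr (2 * p)
       \<le> Re (cinner (blinfun_apply (op_powr (op_abs A) (2 * p)) x) x)"
proof -
  have "Re (cinner (blinfun_apply (op_powr (op_abs A) 2) x) x) = norm (blinfun_apply A x) powr 2"
    by (simp add: op_powr_abs_2[OF A] cinner_op_adjoint'[OF A] Re_cinner_self)
  then have "(norm (blinfun_apply A x) powr 2) powr p \<le> Re (cinner (blinfun_apply (op_powr (op_abs A) (2 * p)) x) x)"
    using mccarthy[OF positive_op_abs[OF A] _ p x, of 2] by simp
  then show ?thesis
    by (simp only: powr_powr)
qed

lemma mixed_schwarz:
  assumes A: "A \<in> bounded_ops"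
  shows "(cmod (cinner (blinfun_apply A x) y))\<^sup>2
       \<le> Re (cinner (blinfun_apply (op_abs A) x) x) * Re (cinner (blinfun_apply (op_abs (op_adjoint A)) y) y)"
proof -
  define T where "T = op_adjoint A o\<^sub>L A"
  define S where "S = A o\<^sub>L op_adjoint A"
  \<comment> \<open>Both norms are dominated so that the two calculi live on one interval, as
    intertwining requires.\<close>
  define M where "M = max (norm T) (norm S)"
  have pT: "positive_op T" and pS: "positive_op S"
    using positive_op_adjoint_compose[OF A] positive_op_adjoint_compose[OF op_adjoint_bounded_ops[OF A]]
    by (simp_all add: T_def S_def op_adjoint_op_adjoint[OF A])
  have calcT: "hermitian_calculus T {0..M}" and calcS: "hermitian_calculus S {0..M}"
    using pT pS by (auto intro!: positive_op_calculus simp: M_def)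
  interpret T: hermitian_calculus T "{0..M}" by (fact calcT)
  interpret S: hermitian_calculus S "{0..M}" by (fact calcS)
  define h where "h = (\<lambda>s::real. s powr (1/2))"
  have h: "continuous_on {0..M} h"
    unfolding h_def by (intro continuous_intros) auto
  have absA: "op_abs A = op_fun h T" and absA': "op_abs (op_adjoint A) = op_fun h S"
    by (simp_all add: op_abs_def op_powr_def h_def T_def S_def op_adjoint_op_adjoint[OF A])
  define a where "a = Re (cinner (blinfun_apply (op_fun h T) x) x)"
  define b where "b = Re (cinner (blinfun_apply (op_fun h S) y) y)"
  have a: "0 \<le> a"
    unfolding a_def by (rule T.op_fun_nonneg[OF h]) (simp add: h_def)
  \<comment> \<open>For \<open>e > 0\<close> write \<open>A = f(S) g(S) A = f(S) A g(T)\<close> with \<open>f(s) = (s + e)\<^sup>1\<^sup>/\<^sup>4 = 1 / g(s)\<close>; this replaces the polar decomposition.\<close>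
  have approx: "(cmod (cinner (blinfun_apply A x) y))\<^sup>2 \<le> a * (b + sqrt e * (norm y)\<^sup>2)" if e: "0 < e" for e
  proof -
    define f where "f = (\<lambda>s. (s + e) powr (1/4))"
    define g where "g = (\<lambda>s. (s + e) powr (- (1/4)))"
    have f: "continuous_on {0..M} f" and g: "continuous_on {0..M} g"
      unfolding f_def g_def using e by (auto intro!: continuous_on_powr' continuous_on_add continuous_on_id)
    have "op_fun (\<lambda>s. f s * g s) S = op_fun (\<lambda>_. 1) S"
      by (rule S.op_fun_cong) (use e in \<open>auto simp: f_def g_def simp flip: powr_add\<close>)
    then have fg: "op_fun f S o\<^sub>L op_fun g S = id_blinfun"
      by (simp add: S.op_fun_mult f g S.op_fun_const)
    have "blinfun_apply A x = blinfun_apply (op_fun f S o\<^sub>L op_fun g S) (blinfun_apply A x)"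
      by (simp only: fg) simp
    also have "\<dots> = blinfun_apply (op_fun f S) (blinfun_apply A (blinfun_apply (op_fun g T) x))"
    proof -
      have "blinfun_apply A (blinfun_apply T z) = blinfun_apply S (blinfun_apply A z)" for z
        by (simp add: T_def S_def)
      from op_fun_intertwine[OF calcT calcS this g] show ?thesis
        by simp
    qed
    finally have "cinner (blinfun_apply A x) y
        = cinner (blinfun_apply A (blinfun_apply (op_fun g T) x)) (blinfun_apply (op_fun f S) y)"
      by (simp add: hermitian_opD[OF S.hermitian_op_fun[OF f]])
    then have "(cmod (cinner (blinfun_apply A x) y))\<^sup>2
        \<le> (norm (blinfun_apply A (blinfun_apply (op_fun g T) x)) * norm (blinfun_apply (op_fun f S) y))\<^sup>2"
      by (simp add: cmod_cinner_le power_mono)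
    also have "\<dots> = (norm (blinfun_apply A (blinfun_apply (op_fun g T) x)))\<^sup>2 * (norm (blinfun_apply (op_fun f S) y))\<^sup>2"
      by (rule power_mult_distrib)
    also have "\<dots> \<le> a * (b + sqrt e * (norm y)\<^sup>2)"
    proof (rule mult_mono)
      have "(norm (blinfun_apply A (blinfun_apply (op_fun g T) x)))\<^sup>2
          = Re (cinner (blinfun_apply T (blinfun_apply (op_fun g T) x)) (blinfun_apply (op_fun g T) x))"
        unfolding T_def cinner_adjoint_compose[OF A] Re_cinner_self ..
      also have "\<dots> = Re (cinner (blinfun_apply (op_fun (\<lambda>s. g s * (s * g s)) T) x) x)"
        using g by (simp add: T.cinner_op_fun_mult T.op_fun_mult[of "\<lambda>s. s"] T.op_fun_ident continuous_on_mult continuous_on_id)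
      also have "\<dots> \<le> a"
        unfolding a_def
      proof (rule T.op_fun_mono)
        \<comment> \<open>Dropping \<open>e\<close> from the negative power only increases it, so
          the factor acting on \<open>x\<close> is dominated by \<open>op_abs A\<close>.\<close>
        show "g s * (s * g s) \<le> h s" if s: "s \<in> {0..M}" for s
        proof (cases "s = 0")
          case False
          then have s0: "0 < s"
            using s by simp
          have "g s * (s * g s) = s * (s + e) powr (- (1/2))"
            by (simp add: g_def flip: powr_add)
          also have "\<dots> \<le> s * s powr (- (1/2))"
            using s0 e by (intro mult_left_mono powr_mono2') auto
          also have "\<dots> = h s"
            using s0 by (simp add: powr_mult_base h_def)
          finally show ?thesis .
        qed (simp add: h_def)
      qed (intro continuous_intros g h)+
      finally show "(norm (blinfun_apply A (blinfun_apply (op_fun g T) x)))\<^sup>2 \<le> a" .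
      have "(norm (blinfun_apply (op_fun f S) y))\<^sup>2 = Re (cinner (blinfun_apply (op_fun (\<lambda>s. f s * f s) S) y) y)"
        using f by (simp only: S.cinner_op_fun_mult Re_cinner_self)
      also have "\<dots> \<le> Re (cinner (blinfun_apply (op_fun (\<lambda>s. h s + sqrt e) S) y) y)"
      proof (rule S.op_fun_mono)
        \<comment> \<open>Subadditivity of the square root bounds the factor acting on
          \<open>y\<close> by the absolute value of the adjoint plus \<open>sqrt e\<close>.\<close>
        show "f s * f s \<le> h s + sqrt e" if s: "s \<in> {0..M}" for s
        proof -
          have "f s * f s = sqrt (s + e)"
            using s e by (simp add: f_def powr_half_sqrt flip: powr_add)
          then show ?thesis
            using s e sqrt_add_le_add_sqrt[of s e] by (simp add: h_def powr_half_sqrt)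
        qed
      qed (intro continuous_intros f h)+
      also have "\<dots> = b + sqrt e * (norm y)\<^sup>2"
        using h by (simp add: S.op_fun_add S.op_fun_const b_def blinfun.add_left blinfun.scaleR_left
            cinner_simps Re_cinner_self)
      finally show "(norm (blinfun_apply (op_fun f S) y))\<^sup>2 \<le> b + sqrt e * (norm y)\<^sup>2" .
    qed (use a in auto)
    finally show ?thesis .
  qed
  \<comment> \<open>Letting \<open>e\<close> tend to \<open>0\<close> from the right removes the
    regularisation.\<close>
  have "((\<lambda>e. a * (b + sqrt e * (norm y)\<^sup>2)) \<longlongrightarrow> a * (b + sqrt 0 * (norm y)\<^sup>2)) (at_right 0)"
    by (intro tendsto_intros)
  moreover have "\<forall>\<^sub>F e in at_right 0. (cmod (cinner (blinfun_apply A x) y))\<^sup>2 \<le> a * (b + sqrt e * (norm y)\<^sup>2)"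
    using approx by (auto simp: eventually_at_right_less intro: eventually_at_rightI[of 0 1])
  ultimately have "(cmod (cinner (blinfun_apply A x) y))\<^sup>2 \<le> a * (b + sqrt 0 * (norm y)\<^sup>2)"
    by (intro tendsto_lowerbound) auto
  then show ?thesis
    by (simp add: a_def b_def absA absA')
qed

text \<open>Mixed Schwarz with both vectors equal to \<open>x\<close>, then AM-GM, bounds
  \<open>w powr p\<close> by the mean of \<open>a powr p\<close> and \<open>b powr p\<close>, and
  McCarthy's inequality bounds that mean by the form of \<open>D\<close>. Cauchy-Schwarz turns the
  form into \<open>norm (D x)\<close>, whose square is the form of \<open>D\<^sup>2\<close>.\<close>

lemma powr_numerical_le_mean:
  assumes A: "A \<in> bounded_ops" and p: "1 \<le> p" and x: "norm x = 1"
  shows "cmod (cinner (blinfun_apply A x) x) powr (2 * p)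
    \<le> Re (cinner (blinfun_apply (op_npow ((1/2) *\<^sub>R (op_powr (op_abs A) p + op_powr (op_abs (op_adjoint A)) p)) 2) x) x)"
proof -
  note A' = op_adjoint_bounded_ops[OF A]
  define w where "w = cmod (cinner (blinfun_apply A x) x)"
  define D where "D = (1/2) *\<^sub>R (op_powr (op_abs A) p + op_powr (op_abs (op_adjoint A)) p)"
  define a where "a = Re (cinner (blinfun_apply (op_abs A) x) x)"
  define b where "b = Re (cinner (blinfun_apply (op_abs (op_adjoint A)) x) x)"
  have ab: "0 \<le> a" "0 \<le> b"
    using positive_op_abs[OF A] positive_op_abs[OF A'] by (simp_all add: a_def b_def positive_op_def)
  have D: "hermitian_op D"
    unfolding D_def using positive_op_powr[of _ p] positive_op_abs[OF A] positive_op_abs[OF A'] p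
    by (intro hermitian_op_scaleR hermitian_op_add) (auto simp: positive_op_def)
  have "(w powr p)\<^sup>2 = (w\<^sup>2) powr p"
    by (simp add: w_def power2_eq_square powr_mult)
  also have "\<dots> \<le> (a * b) powr p"
    using mixed_schwarz[OF A, of x x] p by (intro powr_mono2) (auto simp: w_def a_def b_def)
  also have "\<dots> = a powr p * b powr p"
    using ab by (simp add: powr_mult)
  also have "\<dots> \<le> ((a powr p + b powr p) / 2)\<^sup>2"
    using sum_squares_bound[of "a powr p" "b powr p"] by (simp add: power2_eq_square field_simps)
  finally have "w powr p \<le> (a powr p + b powr p) / 2"
    by (rule power2_le_imp_le) simp
  also have "\<dots> \<le> Re (cinner (blinfun_apply D x) x)"
    using mccarthy[OF positive_op_abs[OF A] _ p x, of 1] mccarthy[OF positive_op_abs[OF A'] _ p x, of 1]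
    by (simp add: D_def a_def b_def op_powr_one positive_op_abs A A' blinfun.add_left blinfun.scaleR_left cinner_simps)
  also have "\<dots> \<le> norm (blinfun_apply D x)"
    using Re_cinner_le[of "blinfun_apply D x" x] x by simp
  finally have "(w powr p)\<^sup>2 \<le> (norm (blinfun_apply D x))\<^sup>2"
    by (intro power_mono) auto
  also have "\<dots> = Re (cinner (blinfun_apply (op_npow D 2) x) x)"
  proof -
    have "op_npow D 2 = D o\<^sub>L D"
      by (rule blinfun_eqI) (simp add: numeral_2_eq_2)
    then show ?thesis
      by (simp add: hermitian_opD[OF D, of "blinfun_apply D x"] Re_cinner_self)
  qed
  also have "(w powr p)\<^sup>2 = w powr (2 * p)"
    by (simp add: power2_eq_square flip: powr_add)
  finally show ?thesis
    by (simp add: w_def D_def)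
qed

theorem theorem2p6:
  fixes A :: "'a::complex_hilbert \<Rightarrow>\<^sub>L 'a" and t p r :: real
  assumes "A \<in> bounded_ops"
    and "0 \<le> t" and "t \<le> 1"
    and "p \<ge> 1"
    and "r = min t (1 - t)"
  shows "numerical_radius A powr (2 * p) \<le>
    norm ((1 - t) *\<^sub>R op_powr (op_abs (op_adjoint A)) (2 * p)
        + t *\<^sub>R op_powr (op_abs A) (2 * p)
        - (2 * r) *\<^sub>R
            ((1/2) *\<^sub>R (op_powr (op_abs A) (2 * p) + op_powr (op_abs (op_adjoint A)) (2 * p))
             - op_npow ((1/2) *\<^sub>R (op_powr (op_abs A) p + op_powr (op_abs (op_adjoint A)) p)) 2))"
    (is "_ \<le> norm ?K")
proof -
  note A = assms(1) and p = assms(4)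
  note A' = op_adjoint_bounded_ops[OF A]
  have le: "cmod (cinner (blinfun_apply A x) x) powr (2 * p) \<le> norm ?K" if x: "norm x = 1" for x
  proof -
    define w where "w = cmod (cinner (blinfun_apply A x) x) powr (2 * p)"
    define b where "b = Re (cinner (blinfun_apply (op_powr (op_abs A) (2 * p)) x) x)"
    define c where "c = Re (cinner (blinfun_apply (op_powr (op_abs (op_adjoint A)) (2 * p)) x) x)"
    define d where "d = Re (cinner (blinfun_apply (op_npow
        ((1/2) *\<^sub>R (op_powr (op_abs A) p + op_powr (op_abs (op_adjoint A)) p)) 2) x) x)"
    have "w \<le> norm (blinfun_apply A x) powr (2 * p)"
      unfolding w_def using p x cmod_cinner_le[of "blinfun_apply A x" x] by (intro powr_mono2) auto
    then have wb: "w \<le> b"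
      using norm_powr_le_op_abs[OF A p x] by (simp add: b_def)
    have "w \<le> norm (blinfun_apply (op_adjoint A) x) powr (2 * p)"
      unfolding w_def using p x cmod_cinner_le[of x "blinfun_apply (op_adjoint A) x"]
      by (intro powr_mono2) (auto simp: cinner_op_adjoint[OF A])
    then have wc: "w \<le> c"
      using norm_powr_le_op_abs[OF A' p x] by (simp add: c_def)
    have wd: "w \<le> d"
      unfolding w_def d_def by (rule powr_numerical_le_mean[OF A p x])
    have "w \<le> (1 - t) * c + t * b - 2 * r * ((b + c) / 2 - d)"
    \<comment> \<open>Here \<open>r = t\<close>, and the right-hand side is
      \<open>(1 - 2 * t) * c + 2 * t * d\<close>, a convex combination of upper bounds of
      \<open>w\<close>. In the other case \<open>r = 1 - t\<close> and it is
      \<open>(2 * t - 1) * b + (2 - 2 * t) * d\<close>.\<close>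
    proof (cases "t \<le> 1 / 2")
      case True
      then have "(1 - 2 * t) * w + 2 * t * w \<le> (1 - 2 * t) * c + 2 * t * d"
        using assms(2) wc wd by (intro add_mono mult_left_mono) auto
      with True assms(5) show ?thesis
        by (simp add: min_def field_simps)
    next
      case False
      then have "(2 * t - 1) * w + (2 - 2 * t) * w \<le> (2 * t - 1) * b + (2 - 2 * t) * d"
        using assms(3) wb wd by (intro add_mono mult_left_mono) auto
      moreover have r: "r = 1 - t"
        using False assms(5) by simp
      ultimately show ?thesis
        unfolding r by (simp add: field_simps)
    qed
    also have "\<dots> = Re (cinner (blinfun_apply ?K x) x)"
      by (simp add: b_def c_def d_def blinfun.add_left blinfun.diff_left blinfun.scaleR_left cinner_simps)
    also have "\<dots> \<le> norm (blinfun_apply ?K x) * norm x"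
      by (rule Re_cinner_le)
    also have "\<dots> \<le> norm ?K"
      using norm_blinfun[of ?K x] x by simp
    finally show ?thesis
      by (simp add: w_def)
  qed
  \<comment> \<open>The supremum is taken of the moduli themselves, so the root of order
    \<open>2 * p\<close> is extracted first and the power restored afterwards.\<close>
  have "cmod (cinner (blinfun_apply A x) x) \<le> norm ?K powr (1 / (2 * p))" if "norm x = 1" for x
    using powr_mono2[of "1 / (2 * p)", OF _ _ le[OF that]] p by (simp add: powr_powr)
  then have "numerical_radius A \<le> norm ?K powr (1 / (2 * p))"
    unfolding numerical_radius_def by (intro cSup_least) auto
  \<comment> \<open>Monotonicity of the real power needs a nonnegative base. The inserted
    \<open>0\<close> provides it once the set is known to be bounded above.\<close>
  moreover have "0 \<le> numerical_radius A"
    unfolding numerical_radius_def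
  proof (rule cSup_upper)
    show "bdd_above (insert 0 {cmod (cinner (blinfun_apply A x) x) |x. norm x = 1})"
      using norm_blinfun[of A] cmod_cinner_le[of "blinfun_apply A _"]
      by (intro bdd_aboveI[of _ "norm A"]) (auto, metis mult.right_neutral order_trans)
  qed simp
  ultimately have "numerical_radius A powr (2 * p) \<le> (norm ?K powr (1 / (2 * p))) powr (2 * p)"
    using p by (intro powr_mono2) auto
  then show ?thesis
    using p by (simp add: powr_powr)
qed

end
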